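(* Let $(M,g_L)$ be a Lorentzian manifold, $E$ a timelike unitary vector field on $M$, $\omega=g_L(E,\cdot)$, and $\overline{M}$ a lightlike hypersurface of $M$ with lightlike vector field $\xi\in\mathfrak{X}(\overline{M})$ normalized by $g_L(E,\xi)=\frac1{\sqrt2}$. Let $\mathcal{S}=T\overline{M}\cap E^\perp$, $N=\sqrt2E+\xi$, and let $g_R=g_L+2\,\omega\otimes\omega$ be the standard canonical variation. Let $\mathbb{I}$ be the second fundamental form of $\overline{M}$ in $(M,g_R)$. Then for $X,Y\in\mathcal{S}$, $$\mathbb{I}(X,Y)=\left(B(X,Y)-\frac{1}{\sqrt2}(L_Eg_L)(X,Y)\right)N,$$ $$\mathbb{I}(X,\xi)=-g_L(\nabla^L_{E+\sqrt2\,\xi}E,X)\,N,$$ $$\mathbb{I}(\xi,\xi)=-\big(2g_L(\xi,\nabla^L_EE)+\tau(\xi)\big)N.$$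
   Context: Lorentzian metrics have signature $(-,+,\dots,+)$; timelike unitary means $g_L(E,E)=-1$. A lightlike hypersurface is a hypersurface on which the induced metric is degenerate. $\nabla^L$ is the Levi-Civita connection of $g_L$. The second fundamental form of $\overline{M}$ in $(M,g_L)$ with respect to $\xi$ is $B(U,V)=-g_L(\nabla^L_U\xi,V)$ for $U,V\in\mathfrak{X}(\overline{M})$. The one form $\tau$ on $\overline{M}$ is defined by the decomposition $\nabla^L_U\xi=-\tau(U)\xi-A^*(U)$ with $A^*(U)\in\mathcal{S}$; in particular $\nabla^L_\xi\xi=-\tau(\xi)\xi$ and $\tau(\xi)=\sqrt2\,g_L(\nabla^L_\xi E,\xi)$. The vector field $N$ is the $g_R$-unit normal to $\overline{M}$, and $\mathbb{I}(U,V)$ is the $g_R$-normal component of $\nabla^R_UV$, $\nabla^R$ being the Levi-Civita connection of $g_R$. *)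

theory Defs
  imports "HOL-Analysis.Analysis" "HOL-Library.Function_Algebras"
begin

section \<open>Smooth functions between Euclidean spaces\<close>

text \<open>These are meant for open sets \<open>S\<close>. On such a set, for a finite-dimensional domain, all iterated
  directional derivatives exist and are continuous iff the function is infinitely differentiable.\<close>

primrec Ck_on :: "nat \<Rightarrow> 'a::euclidean_space set \<Rightarrow> ('a \<Rightarrow> 'b::real_normed_vector) \<Rightarrow> bool" where
  "Ck_on 0 S f \<longleftrightarrow> continuous_on S f"
| "Ck_on (Suc k) S f \<longleftrightarrow> (\<forall>x\<in>S. f differentiable (at x)) \<and>
     (\<forall>v. Ck_on k S (\<lambda>x. frechet_derivative f (at x) v))"

definition smooth_on :: "'a::euclidean_space set \<Rightarrow> ('a \<Rightarrow> 'b::real_normed_vector) \<Rightarrow> bool" where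
  "smooth_on S f \<longleftrightarrow> (\<forall>k. Ck_on k S f)"


section \<open>Smooth manifolds\<close>

text \<open>The underlying topological space of a manifold is a Hausdorff, second countable type \<open>'m\<close>; its
  dimension is \<open>DIM('e)\<close>. A chart is a pair of a domain and a coordinate map, the values of the
  latter outside of the domain being irrelevant. A smooth structure is a maximal smooth atlas.\<close>

type_synonym ('m, 'e) chart = "'m set \<times> ('m \<Rightarrow> 'e)"

definition chart_inv :: "('m, 'e) chart \<Rightarrow> 'e \<Rightarrow> 'm" where
  "chart_inv c = inv_into (fst c) (snd c)"

definition is_chart :: "('m::topological_space, 'e::euclidean_space) chart \<Rightarrow> bool" where
  "is_chart c \<longleftrightarrow> open (fst c) \<and> open (snd c ` fst c) \<and>
     homeomorphism (fst c) (snd c ` fst c) (snd c) (chart_inv c)"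

definition compatible :: "('m, 'e::euclidean_space) chart \<Rightarrow> ('m, 'e) chart \<Rightarrow> bool" where
  "compatible c d \<longleftrightarrow>
     smooth_on (snd c ` (fst c \<inter> fst d)) (snd d \<circ> chart_inv c) \<and>
     smooth_on (snd d ` (fst c \<inter> fst d)) (snd c \<circ> chart_inv d)"

definition smooth_structure ::
    "('m::{t2_space,second_countable_topology}, 'e::euclidean_space) chart set \<Rightarrow> bool" where
  "smooth_structure A \<longleftrightarrow>
     (\<forall>c\<in>A. is_chart c) \<and> (\<Union>c\<in>A. fst c) = UNIV \<and> (\<forall>c\<in>A. \<forall>d\<in>A. compatible c d) \<and>
     (\<forall>c. is_chart c \<and> (\<forall>d\<in>A. compatible c d) \<longrightarrow> c \<in> A)"

definition smooth_fun_on ::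
    "('m, 'e::euclidean_space) chart set \<Rightarrow> 'm set \<Rightarrow> ('m \<Rightarrow> real) \<Rightarrow> bool" where
  "smooth_fun_on A U f \<longleftrightarrow> (\<forall>c\<in>A. smooth_on (snd c ` (U \<inter> fst c)) (f \<circ> chart_inv c))"


section \<open>Tangent vectors and vector fields\<close>

text \<open>A tangent vector at \<open>p\<close> is the family of its coordinate vectors in all charts around \<open>p\<close>; they are
  related by the Jacobians of the coordinate changes. The family is extended by \<open>0\<close> to all other
  pairs, so that equality of functions is equality of tangent vectors, and the vector space
  operations are the pointwise ones.\<close>

instantiation "fun" :: (type, real_vector) real_vector
begin

definition scaleR_fun :: "real \<Rightarrow> ('a \<Rightarrow> 'b) \<Rightarrow> 'a \<Rightarrow> 'b" where
  "scaleR_fun r f = (\<lambda>x. r *\<^sub>R f x)"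

instance
  by standard (simp_all add: scaleR_fun_def plus_fun_def fun_eq_iff algebra_simps)

end

type_synonym ('m, 'e) tvec = "('m, 'e) chart \<Rightarrow> 'e"

definition tangent_space ::
    "('m, 'e::euclidean_space) chart set \<Rightarrow> 'm \<Rightarrow> ('m, 'e) tvec set" where
  "tangent_space A p = {v.
     (\<forall>c. \<not> (c \<in> A \<and> p \<in> fst c) \<longrightarrow> v c = 0) \<and>
     (\<forall>c\<in>A. \<forall>d\<in>A. p \<in> fst c \<and> p \<in> fst d \<longrightarrow>
        v d = frechet_derivative (snd d \<circ> chart_inv c) (at (snd c p)) (v c))}"

definition vector_field_on ::
    "('m, 'e::euclidean_space) chart set \<Rightarrow> 'm set \<Rightarrow> ('m \<Rightarrow> ('m, 'e) tvec) \<Rightarrow> bool" where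
  "vector_field_on A U X \<longleftrightarrow> (\<forall>p\<in>U. X p \<in> tangent_space A p) \<and>
     (\<forall>c\<in>A. smooth_on (snd c ` (U \<inter> fst c)) (\<lambda>x. X (chart_inv c x) c))"

text \<open>The derivative \<open>v(f)\<close> of a function along a tangent vector; it does not depend on the chart.\<close>

definition deriv_along ::
    "('m, 'e::euclidean_space) chart set \<Rightarrow> 'm \<Rightarrow> ('m, 'e) tvec \<Rightarrow> ('m \<Rightarrow> real) \<Rightarrow> real" where
  "deriv_along A p v f =
     (let c = (SOME c. c \<in> A \<and> p \<in> fst c)
      in frechet_derivative (f \<circ> chart_inv c) (at (snd c p)) (v c))"

definition lie_bracket ::
    "('m, 'e::euclidean_space) chart set \<Rightarrow> ('m \<Rightarrow> ('m, 'e) tvec) \<Rightarrow> ('m \<Rightarrow> ('m, 'e) tvec) \<Rightarrow>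
     'm \<Rightarrow> ('m, 'e) tvec" where
  "lie_bracket A X Y p = (\<lambda>c. if c \<in> A \<and> p \<in> fst c
     then frechet_derivative (\<lambda>x. Y (chart_inv c x) c) (at (snd c p)) (X p c)
        - frechet_derivative (\<lambda>x. X (chart_inv c x) c) (at (snd c p)) (Y p c)
     else 0)"


section \<open>Lorentzian metrics and the Levi-Civita connection\<close>

type_synonym ('m, 'e) tensor2 = "'m \<Rightarrow> ('m, 'e) tvec \<Rightarrow> ('m, 'e) tvec \<Rightarrow> real"

definition smooth_symmetric_tensor :: "('m::topological_space, 'e::euclidean_space) chart set \<Rightarrow>
    ('m, 'e) tensor2 \<Rightarrow> bool" where
  "smooth_symmetric_tensor A g \<longleftrightarrow>
     (\<forall>p. \<forall>u\<in>tangent_space A p. \<forall>v\<in>tangent_space A p. g p u v = g p v u) \<and>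
     (\<forall>p. \<forall>u\<in>tangent_space A p. \<forall>v\<in>tangent_space A p. \<forall>w\<in>tangent_space A p. \<forall>r.
        g p (u + v) w = g p u w + g p v w \<and> g p (r *\<^sub>R u) w = r * g p u w) \<and>
     (\<forall>U X Y. open U \<and> vector_field_on A U X \<and> vector_field_on A U Y \<longrightarrow>
        smooth_fun_on A U (\<lambda>p. g p (X p) (Y p)))"

text \<open>Signature \<open>(-,+,\<dots>,+)\<close>: every tangent space has an orthonormal basis, indexed by the
  \<open>DIM('e)\<close> elements of \<open>Basis\<close>, with exactly one timelike member.\<close>

definition lorentzian_metric :: "('m::topological_space, 'e::euclidean_space) chart set \<Rightarrow>
    ('m, 'e) tensor2 \<Rightarrow> bool" where
  "lorentzian_metric A g \<longleftrightarrow> smooth_symmetric_tensor A g \<and>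
     (\<forall>p. \<exists>e :: 'e \<Rightarrow> ('m, 'e) tvec. \<exists>b\<^sub>0\<in>Basis.
        (\<forall>b\<in>Basis. e b \<in> tangent_space A p) \<and>
        (\<forall>b\<in>Basis. \<forall>b'\<in>Basis.
           g p (e b) (e b') = (if b \<noteq> b' then 0 else if b = b\<^sub>0 then -1 else 1)))"

text \<open>A connection is a map \<open>(p, u, V) \<mapsto> \<nabla>\<^sub>u V\<close> where \<open>u\<close> is a tangent vector at \<open>p\<close> and \<open>V\<close> a smooth
  vector field on some open neighbourhood of \<open>p\<close>. As is customary, it is considered as acting on
  local fields, compatibly with restriction (the clause on \<open>V\<close> and \<open>W\<close> that agree on \<open>U\<close>).\<close>

type_synonym ('m, 'e) connection =
  "'m \<Rightarrow> ('m, 'e) tvec \<Rightarrow> ('m \<Rightarrow> ('m, 'e) tvec) \<Rightarrow> ('m, 'e) tvec"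

definition affine_connection :: "('m::topological_space, 'e::euclidean_space) chart set \<Rightarrow>
    ('m, 'e) connection \<Rightarrow> bool" where
  "affine_connection A nabla \<longleftrightarrow> (\<forall>U V. open U \<and> vector_field_on A U V \<longrightarrow>
     (\<forall>p\<in>U. \<forall>u\<in>tangent_space A p. nabla p u V \<in> tangent_space A p) \<and>
     (\<forall>p\<in>U. \<forall>u\<in>tangent_space A p. \<forall>v\<in>tangent_space A p. \<forall>r.
        nabla p (u + v) V = nabla p u V + nabla p v V \<and>
        nabla p (r *\<^sub>R u) V = r *\<^sub>R nabla p u V) \<and>
     (\<forall>W. vector_field_on A U W \<longrightarrow> (\<forall>p\<in>U. \<forall>u\<in>tangent_space A p.
        nabla p u (\<lambda>q. V q + W q) = nabla p u V + nabla p u W)) \<and>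
     (\<forall>f. smooth_fun_on A U f \<longrightarrow> (\<forall>p\<in>U. \<forall>u\<in>tangent_space A p.
        nabla p u (\<lambda>q. f q *\<^sub>R V q) = deriv_along A p u f *\<^sub>R V p + f p *\<^sub>R nabla p u V)) \<and>
     (\<forall>W. (\<forall>q\<in>U. W q = V q) \<longrightarrow> (\<forall>p\<in>U. \<forall>u\<in>tangent_space A p.
        nabla p u W = nabla p u V)) \<and>
     (\<forall>X. vector_field_on A U X \<longrightarrow> vector_field_on A U (\<lambda>p. nabla p (X p) V)))"

definition levi_civita :: "('m::topological_space, 'e::euclidean_space) chart set \<Rightarrow>
    ('m, 'e) tensor2 \<Rightarrow> ('m, 'e) connection \<Rightarrow> bool" where
  "levi_civita A g nabla \<longleftrightarrow> affine_connection A nabla \<and>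
     (\<forall>U X Y. open U \<and> vector_field_on A U X \<and> vector_field_on A U Y \<longrightarrow>
        (\<forall>p\<in>U. nabla p (X p) Y - nabla p (Y p) X = lie_bracket A X Y p) \<and>
        (\<forall>p\<in>U. \<forall>u\<in>tangent_space A p.
           deriv_along A p u (\<lambda>q. g q (X q) (Y q)) =
             g p (nabla p u X) (Y p) + g p (X p) (nabla p u Y)))"

text \<open>The tensor \<open>(L\<^sub>E g)(X, Y) = E (g(X, Y)) - g([E, X], Y) - g(X, [E, Y])\<close>, evaluated on tangent
  vectors \<open>x\<close>, \<open>y\<close> at \<open>p\<close> by means of arbitrary local extensions \<open>X\<close>, \<open>Y\<close>.\<close>

definition lie_derivative :: "('m::topological_space, 'e::euclidean_space) chart set \<Rightarrow>
    ('m \<Rightarrow> ('m, 'e) tvec) \<Rightarrow> ('m, 'e) tensor2 \<Rightarrow> ('m, 'e) tensor2" where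
  "lie_derivative A E g p x y = (THE r. \<forall>U X Y.
     open U \<and> p \<in> U \<and> vector_field_on A U X \<and> vector_field_on A U Y \<and> X p = x \<and> Y p = y \<longrightarrow>
     r = deriv_along A p (E p) (\<lambda>q. g q (X q) (Y q))
         - g p (lie_bracket A E X p) (Y p) - g p (X p) (lie_bracket A E Y p))"

definition canonical_variation :: "('m, 'e::euclidean_space) tensor2 \<Rightarrow>
    ('m \<Rightarrow> ('m, 'e) tvec) \<Rightarrow> ('m, 'e) tensor2" where
  "canonical_variation g E p u v = (let \<omega> = g p (E p) in g p u v + 2 * (\<omega> u * \<omega> v))"


section \<open>Hypersurfaces\<close>

text \<open>A hypersurface is an embedded submanifold of codimension one, described by slice charts.\<close>

definition slice_chart :: "('m, 'e::euclidean_space) chart set \<Rightarrow> 'm set \<Rightarrow>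
    'e \<Rightarrow> ('m, 'e) chart \<Rightarrow> bool" where
  "slice_chart A H b c \<longleftrightarrow> c \<in> A \<and> b \<in> Basis \<and>
     snd c ` (fst c \<inter> H) = snd c ` fst c \<inter> {x. x \<bullet> b = 0}"

definition hypersurface :: "('m, 'e::euclidean_space) chart set \<Rightarrow> 'm set \<Rightarrow> bool" where
  "hypersurface A H \<longleftrightarrow> (\<forall>p\<in>H. \<exists>b c. slice_chart A H b c \<and> p \<in> fst c)"

definition hyp_tangent_space :: "('m, 'e::euclidean_space) chart set \<Rightarrow> 'm set \<Rightarrow> 'm \<Rightarrow>
    ('m, 'e) tvec set" where
  "hyp_tangent_space A H p = {v \<in> tangent_space A p.
     \<exists>b c. slice_chart A H b c \<and> p \<in> fst c \<and> v c \<bullet> b = 0}"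

text \<open>The slice charts, restricted to \<open>H\<close> and with the hyperplane \<open>{x. x \<bullet> b = 0}\<close> as codomain, are the
  charts of \<open>H\<close>. Smoothness on a (not open) slice of a hyperplane is smoothness on its preimage
  under the orthogonal projection \<open>x \<mapsto> x - (x \<bullet> b) b\<close>, which is open in the whole space.\<close>

definition hyp_vector_field :: "('m, 'e::euclidean_space) chart set \<Rightarrow> 'm set \<Rightarrow>
    ('m \<Rightarrow> ('m, 'e) tvec) \<Rightarrow> bool" where
  "hyp_vector_field A H V \<longleftrightarrow> (\<forall>p\<in>H. V p \<in> hyp_tangent_space A H p) \<and>
     (\<forall>b c. slice_chart A H b c \<longrightarrow>
        smooth_on {x. x - (x \<bullet> b) *\<^sub>R b \<in> snd c ` fst c}
          (\<lambda>x. V (chart_inv c (x - (x \<bullet> b) *\<^sub>R b)) c))"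

definition lightlike :: "(('m, 'e) tvec \<Rightarrow> ('m, 'e) tvec \<Rightarrow> real) \<Rightarrow>
    ('m, 'e::euclidean_space) tvec \<Rightarrow> bool" where
  "lightlike h v \<longleftrightarrow> v \<noteq> 0 \<and> h v v = 0"

definition lightlike_hypersurface :: "('m, 'e::euclidean_space) chart set \<Rightarrow> ('m, 'e) tensor2 \<Rightarrow>
    'm set \<Rightarrow> bool" where
  "lightlike_hypersurface A g H \<longleftrightarrow> hypersurface A H \<and>
     (\<forall>p\<in>H. \<exists>v\<in>hyp_tangent_space A H p. v \<noteq> 0 \<and> (\<forall>w\<in>hyp_tangent_space A H p. g p v w = 0))"

text \<open>The covariant derivative of a vector field \<open>V\<close> given only along \<open>H\<close>, in a direction \<open>u\<close> tangent to
  \<open>H\<close>, is that of any local extension of \<open>V\<close>.\<close>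

definition nabla_along :: "('m::topological_space, 'e::euclidean_space) chart set \<Rightarrow> 'm set \<Rightarrow>
    ('m, 'e) connection \<Rightarrow> ('m, 'e) connection" where
  "nabla_along A H nabla p u V = (THE w. \<forall>U W.
     open U \<and> p \<in> U \<and> vector_field_on A U W \<and> (\<forall>q\<in>U \<inter> H. W q = V q) \<longrightarrow> w = nabla p u W)"

text \<open>The component of \<open>\<nabla>\<^sub>U V\<close> that is \<open>g\<close>-orthogonal to \<open>H\<close>.\<close>

definition second_fundamental_form :: "('m::topological_space, 'e::euclidean_space) chart set \<Rightarrow>
    ('m, 'e) tensor2 \<Rightarrow> ('m, 'e) connection \<Rightarrow> 'm set \<Rightarrow>
    ('m \<Rightarrow> ('m, 'e) tvec) \<Rightarrow> ('m \<Rightarrow> ('m, 'e) tvec) \<Rightarrow> 'm \<Rightarrow> ('m, 'e) tvec" where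
  "second_fundamental_form A g nabla H U V p = (THE n.
     n \<in> tangent_space A p \<and> (\<forall>w\<in>hyp_tangent_space A H p. g p n w = 0) \<and>
     nabla_along A H nabla p (U p) V - n \<in> hyp_tangent_space A H p)"

text \<open>The screen distribution \<open>TH \<inter> E\<^sup>\<bottom>\<close>.\<close>

definition screen :: "('m, 'e::euclidean_space) chart set \<Rightarrow> ('m, 'e) tensor2 \<Rightarrow> 'm set \<Rightarrow>
    ('m \<Rightarrow> ('m, 'e) tvec) \<Rightarrow> 'm \<Rightarrow> ('m, 'e) tvec set" where
  "screen A g H E p = {v \<in> hyp_tangent_space A H p. g p (E p) v = 0}"

definition screen_field :: "('m, 'e::euclidean_space) chart set \<Rightarrow> ('m, 'e) tensor2 \<Rightarrow> 'm set \<Rightarrow>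
    ('m \<Rightarrow> ('m, 'e) tvec) \<Rightarrow> ('m \<Rightarrow> ('m, 'e) tvec) \<Rightarrow> bool" where
  "screen_field A g H E X \<longleftrightarrow> hyp_vector_field A H X \<and> (\<forall>p\<in>H. X p \<in> screen A g H E p)"

definition null_second_fundamental_form ::
    "('m::topological_space, 'e::euclidean_space) chart set \<Rightarrow>
    ('m, 'e) tensor2 \<Rightarrow> ('m, 'e) connection \<Rightarrow> 'm set \<Rightarrow> ('m \<Rightarrow> ('m, 'e) tvec) \<Rightarrow>
    ('m \<Rightarrow> ('m, 'e) tvec) \<Rightarrow> ('m \<Rightarrow> ('m, 'e) tvec) \<Rightarrow> 'm \<Rightarrow> real" where
  "null_second_fundamental_form A g nabla H \<xi> U V p =
     - g p (nabla_along A H nabla p (U p) \<xi>) (V p)"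

text \<open>The one-form \<open>\<tau>\<close> determined by \<open>\<nabla>\<^sub>u \<xi> = - \<tau>(u) \<xi> - a\<close> with \<open>a\<close> in the screen distribution.\<close>

definition rotation_form :: "('m::topological_space, 'e::euclidean_space) chart set \<Rightarrow>
    ('m, 'e) tensor2 \<Rightarrow> ('m, 'e) connection \<Rightarrow> 'm set \<Rightarrow> ('m \<Rightarrow> ('m, 'e) tvec) \<Rightarrow>
    ('m \<Rightarrow> ('m, 'e) tvec) \<Rightarrow> 'm \<Rightarrow> ('m, 'e) tvec \<Rightarrow> real" where
  "rotation_form A g nabla H E \<xi> p u = (THE t. \<exists>a\<in>screen A g H E p.
     nabla_along A H nabla p u \<xi> = - (t *\<^sub>R \<xi> p) - a)"

end

theory Submission
  imports Defs
begin

text \<open>The idea is to compare the two Levi-Civita connections. Put \<open>\<omega> = g\<^sub>L(E, \<cdot>)\<close>,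
  \<open>a(u, v) = g\<^sub>L(\<nabla>\<^sup>L\<^sub>u E, v)\<close> and \<open>D(X, Y) = \<nabla>\<^sup>R\<^sub>X Y - \<nabla>\<^sup>L\<^sub>X Y\<close>. Both connections are torsion free, so \<open>D\<close> is
  symmetric; both are metric, and \<open>g\<^sub>R - g\<^sub>L = 2 \<omega> \<otimes> \<omega>\<close>, which gives the Koszul-type formula
  (\<open>difference_of_connections\<close>)
  \<open>g\<^sub>R(D(X, Y), Z) = \<omega>(Z) (a(X, Y) + a(Y, X)) + \<omega>(Y) (a(X, Z) - a(Z, X)) + \<omega>(X) (a(Y, Z) - a(Z, Y))\<close>.
  The symmetric part of \<open>a\<close> is half of \<open>L\<^sub>E g\<^sub>L\<close> (\<open>lie_derivative_eq\<close>).

  The field \<open>\<xi>\<close> is \<open>g\<^sub>L\<close>-orthogonal to \<open>TH\<close> (\<open>xi_orthogonal\<close>). It follows that \<open>N = \<surd>2 E + \<xi>\<close> is the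
  \<open>g\<^sub>R\<close>-unit normal and that \<open>g\<^sub>R(W, N) = g\<^sub>L(W, \<xi>)\<close> for every \<open>W\<close> (\<open>gR_N\<close>). Therefore the second
  fundamental form is \<open>(g\<^sub>L(\<nabla>\<^sup>L\<^sub>V W, \<xi>) + g\<^sub>R(D(V, W), N)) N\<close>; inserting \<open>Z = N\<close>, \<open>\<omega>(N) = - 1 / \<surd>2\<close> and
  \<open>a(\<cdot>, E) = 0\<close> gives a closed formula for all tangent fields (\<open>second_fundamental_form_gR\<close>). Its
  first term is \<open>- g\<^sub>L(\<nabla>\<^sup>L\<^sub>V \<xi>, W)\<close>, that is \<open>B(V, W)\<close>, and vanishes for \<open>W = \<xi>\<close>. Specialising to
  \<open>(X, Y)\<close>, \<open>(X, \<xi>)\<close> and \<open>(\<xi>, \<xi>)\<close>, together with \<open>\<tau>(\<xi>) = \<surd>2 a(\<xi>, \<xi>)\<close> (\<open>rotation_form_eq\<close>), proves the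
  theorem.

  The fields \<open>X\<close>, \<open>Y\<close> and \<open>\<xi>\<close> live only on \<open>H\<close>, so this computation needs local extensions
  (\<open>ex_extension\<close>), and the results must not depend on them. The latter rests on one fact: a function
  that is constant on \<open>H\<close> has derivative zero in the directions tangent to \<open>H\<close>
  (\<open>deriv_along_const_on_hypersurface\<close>). With a metric connection and a nondegenerate metric it
  implies that \<open>\<nabla>\<^sub>u V\<close>, for \<open>u\<close> tangent to \<open>H\<close>, depends only on \<open>V\<close> along \<open>H\<close>
  (\<open>nabla_cong_on_hypersurface\<close>).\<close>


section \<open>Calculus of finitely often differentiable maps\<close>

lemma Ck_on_subset: "Ck_on k S f \<Longrightarrow> T \<subseteq> S \<Longrightarrow> Ck_on k T f"
  by (induction k arbitrary: f) (auto intro: continuous_on_subset)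

lemma Ck_on_cong:
  assumes "open S" "\<And>x. x \<in> S \<Longrightarrow> f x = g x" "Ck_on k S f"
  shows "Ck_on k S g"
  using assms(2,3)
proof (induction k arbitrary: f g)
  case 0
  then show ?case by (simp cong: continuous_on_cong)
next
  case (Suc k)
  have D: "(g has_derivative frechet_derivative f (at x)) (at x)" if "x \<in> S" for x
  proof (rule has_derivative_transform_within_open[OF _ assms(1) that])
    show "(f has_derivative frechet_derivative f (at x)) (at x)"
      using Suc.prems(2) that frechet_derivative_works by auto
  qed (rule Suc.prems(1))
  have "Ck_on k S (\<lambda>x. frechet_derivative g (at x) v)" for v
  proof (rule Suc.IH)
    show "frechet_derivative f (at x) v = frechet_derivative g (at x) v" if "x \<in> S" for x
      by (simp only: frechet_derivative_at[OF D[OF that]])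
    show "Ck_on k S (\<lambda>x. frechet_derivative f (at x) v)" using Suc.prems(2) by simp
  qed
  then show ?case using D by (auto simp: differentiable_def)
qed

text \<open>Any formula for the derivative may take the place of \<open>frechet_derivative\<close>, so the rules below
  are inductions along the usual differentiation rules.\<close>

lemma Ck_on_SucI:
  assumes "open S" "\<And>x. x \<in> S \<Longrightarrow> (f has_derivative f' x) (at x)"
    and "\<And>v. Ck_on k S (\<lambda>x. f' x v)"
  shows "Ck_on (Suc k) S f"
proof -
  have "Ck_on k S (\<lambda>x. frechet_derivative f (at x) v)" for v
    by (rule Ck_on_cong[OF assms(1) _ assms(3)]) (simp only: frechet_derivative_at[OF assms(2)])
  then show ?thesis using assms(2) by (auto simp: differentiable_def)
qed

lemma Ck_on_has_derivative:
  "Ck_on (Suc k) S f \<Longrightarrow> x \<in> S \<Longrightarrow> (f has_derivative frechet_derivative f (at x)) (at x)"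
  by (simp add: frechet_derivative_works[symmetric])

lemma Ck_on_SucD: "Ck_on (Suc k) S f \<Longrightarrow> Ck_on k S f"
proof (induction k arbitrary: f)
  case 0
  then show ?case
    by (auto intro!: continuous_at_imp_continuous_on differentiable_imp_continuous_within)
qed simp

lemma Ck_on_const: "Ck_on k S (\<lambda>_. c)"
  by (induction k arbitrary: c) auto

lemma Ck_on_add:
  assumes "open S" "Ck_on k S f" "Ck_on k S g"
  shows "Ck_on k S (\<lambda>x. f x + g x)"
  using assms(2,3)
proof (induction k arbitrary: f g)
  case (Suc k)
  show ?case
  proof (rule Ck_on_SucI[OF assms(1)])
    show "((\<lambda>x. f x + g x) has_derivative
        (\<lambda>v. frechet_derivative f (at x) v + frechet_derivative g (at x) v)) (at x)"
      if "x \<in> S" for x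
      using Suc.prems that by (intro has_derivative_add Ck_on_has_derivative)
  qed (use Suc in auto)
qed (simp add: continuous_on_add)

lemma Ck_on_sum:
  assumes "open S" "\<And>i. i \<in> I \<Longrightarrow> Ck_on k S (f i)"
  shows "Ck_on k S (\<lambda>x. \<Sum>i\<in>I. f i x)"
  using assms(2)
  by (induction I rule: infinite_finite_induct) (auto intro: Ck_on_const Ck_on_add[OF assms(1)])

lemma Ck_on_bounded_linear:
  assumes "open S" "bounded_linear L" "Ck_on k S f"
  shows "Ck_on k S (\<lambda>x. L (f x))"
  using assms(3)
proof (induction k arbitrary: f)
  case 0
  then show ?case using assms(2) by (auto intro: bounded_linear.continuous_on)
next
  case (Suc k)
  show ?case
  proof (rule Ck_on_SucI[OF assms(1)])
    show "((\<lambda>x. L (f x)) has_derivative (\<lambda>v. L (frechet_derivative f (at x) v))) (at x)"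
      if "x \<in> S" for x
      using Suc.prems that by (intro bounded_linear.has_derivative[OF assms(2)] Ck_on_has_derivative)
  qed (use Suc in auto)
qed

lemma Ck_on_scaleR:
  assumes "open S" "Ck_on k S f" "Ck_on k S g"
  shows "Ck_on k S (\<lambda>x. f x *\<^sub>R g x)"
  using assms(2,3)
proof (induction k arbitrary: f g)
  case (Suc k)
  show ?case
  proof (rule Ck_on_SucI[OF assms(1)])
    show "((\<lambda>x. f x *\<^sub>R g x) has_derivative
        (\<lambda>v. f x *\<^sub>R frechet_derivative g (at x) v + frechet_derivative f (at x) v *\<^sub>R g x)) (at x)"
      if "x \<in> S" for x
      using Suc.prems that by (intro has_derivative_scaleR Ck_on_has_derivative)
    show "Ck_on k S (\<lambda>x. f x *\<^sub>R frechet_derivative g (at x) v + frechet_derivative f (at x) v *\<^sub>R g x)"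
      for v
      using Suc.prems Ck_on_SucD[OF Suc.prems(1)] Ck_on_SucD[OF Suc.prems(2)]
      by (intro Ck_on_add[OF assms(1)] Suc.IH) auto
  qed
qed (simp add: continuous_on_scaleR)

lemma linear_expand_Basis:
  fixes L :: "'a::euclidean_space \<Rightarrow> 'b::real_vector"
  assumes "linear L"
  shows "L v = (\<Sum>b\<in>Basis. (v \<bullet> b) *\<^sub>R L b)"
proof -
  have "L v = L (\<Sum>b\<in>Basis. (v \<bullet> b) *\<^sub>R b)"
    by (simp add: euclidean_representation)
  then show ?thesis
    by (simp add: linear_sum[OF assms] linear_cmul[OF assms])
qed

text \<open>The directional derivative \<open>D(f \<circ> g)(x) v\<close> is expanded along \<open>Basis\<close>, which makes it a sum of
  products of directional derivatives of \<open>g\<close> and of \<open>f\<close>, the latter again composed with \<open>g\<close>;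
  this is the form on which the induction hypothesis acts.\<close>

lemma Ck_on_compose:
  fixes f :: "'b::euclidean_space \<Rightarrow> 'c::real_normed_vector"
    and g :: "'a::euclidean_space \<Rightarrow> 'b"
  assumes "open S" "Ck_on k S g" "Ck_on k T f" "g ` S \<subseteq> T"
  shows "Ck_on k S (\<lambda>x. f (g x))"
  using assms(2,3)
proof (induction k arbitrary: f)
  case 0
  then show ?case using assms(4) by (auto intro: continuous_on_compose2)
next
  case (Suc k)
  show ?case
  proof (rule Ck_on_SucI[OF assms(1)])
    fix x assume x: "x \<in> S"
    have f: "(f has_derivative frechet_derivative f (at (g x))) (at (g x))"
      using x assms(4) by (intro Ck_on_has_derivative[OF Suc.prems(2)]) auto
    have "((\<lambda>x. f (g x)) has_derivative
        (\<lambda>v. frechet_derivative f (at (g x)) (frechet_derivative g (at x) v))) (at x)"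
      by (rule has_derivative_compose[OF Ck_on_has_derivative[OF Suc.prems(1) x],
            where g = f and g' = "frechet_derivative f (at (g x))"]) (rule f)
    then show "((\<lambda>x. f (g x)) has_derivative (\<lambda>v. \<Sum>b\<in>Basis.
        (frechet_derivative g (at x) v \<bullet> b) *\<^sub>R frechet_derivative f (at (g x)) b)) (at x)"
      by (simp only: linear_expand_Basis[OF has_derivative_linear[OF f], symmetric])
  next
    fix v
    have "Ck_on k S (\<lambda>x. frechet_derivative f (at (g x)) b)" for b
      using Suc.prems by (intro Suc.IH Ck_on_SucD[OF Suc.prems(1)]) auto
    moreover have "Ck_on k S (\<lambda>x. frechet_derivative g (at x) v \<bullet> b)" for b
      using Suc.prems
      by (intro Ck_on_bounded_linear[OF assms(1) bounded_linear_inner_left]) auto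
    ultimately show "Ck_on k S (\<lambda>x. \<Sum>b\<in>Basis.
        (frechet_derivative g (at x) v \<bullet> b) *\<^sub>R frechet_derivative f (at (g x)) b)"
      by (intro Ck_on_sum Ck_on_scaleR assms(1))
  qed
qed

lemma smooth_on_subset: "smooth_on S f \<Longrightarrow> T \<subseteq> S \<Longrightarrow> smooth_on T f"
  unfolding smooth_on_def by (blast intro: Ck_on_subset)

lemma smooth_on_cong: "open S \<Longrightarrow> (\<And>x. x \<in> S \<Longrightarrow> f x = g x) \<Longrightarrow> smooth_on S f \<Longrightarrow> smooth_on S g"
  unfolding smooth_on_def by (blast intro: Ck_on_cong)

lemma smooth_on_const: "smooth_on S (\<lambda>_. c)"
  by (simp add: smooth_on_def Ck_on_const)

lemma smooth_on_add:
  "open S \<Longrightarrow> smooth_on S f \<Longrightarrow> smooth_on S g \<Longrightarrow> smooth_on S (\<lambda>x. f x + g x)"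
  unfolding smooth_on_def by (blast intro: Ck_on_add)

lemma smooth_on_sum:
  "open S \<Longrightarrow> (\<And>i. i \<in> I \<Longrightarrow> smooth_on S (f i)) \<Longrightarrow> smooth_on S (\<lambda>x. \<Sum>i\<in>I. f i x)"
  unfolding smooth_on_def by (blast intro: Ck_on_sum)

lemma smooth_on_scaleR:
  "open S \<Longrightarrow> smooth_on S f \<Longrightarrow> smooth_on S g \<Longrightarrow> smooth_on S (\<lambda>x. f x *\<^sub>R g x)"
  unfolding smooth_on_def by (blast intro: Ck_on_scaleR)

lemma smooth_on_bounded_linear:
  "open S \<Longrightarrow> bounded_linear L \<Longrightarrow> smooth_on S f \<Longrightarrow> smooth_on S (\<lambda>x. L (f x))"
  unfolding smooth_on_def by (blast intro: Ck_on_bounded_linear)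

lemma smooth_on_compose:
  fixes f :: "'b::euclidean_space \<Rightarrow> 'c::real_normed_vector"
    and g :: "'a::euclidean_space \<Rightarrow> 'b"
  shows "open S \<Longrightarrow> smooth_on S g \<Longrightarrow> smooth_on T f \<Longrightarrow> g ` S \<subseteq> T \<Longrightarrow> smooth_on S (\<lambda>x. f (g x))"
  unfolding smooth_on_def by (blast intro: Ck_on_compose)

lemma smooth_on_has_derivative:
  "smooth_on S f \<Longrightarrow> x \<in> S \<Longrightarrow> (f has_derivative frechet_derivative f (at x)) (at x)"
  unfolding smooth_on_def by (blast intro: Ck_on_has_derivative[where k = 0])

lemma smooth_on_frechet_derivative:
  assumes "smooth_on S f"
  shows "smooth_on S (\<lambda>x. frechet_derivative f (at x) v)"
  unfolding smooth_on_def
proof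
  fix k
  have "Ck_on (Suc k) S f" using assms by (simp only: smooth_on_def)
  then show "Ck_on k S (\<lambda>x. frechet_derivative f (at x) v)" by simp
qed


section \<open>Charts, tangent vectors and vector fields\<close>

locale manifold =
  fixes A :: "('m::{t2_space,second_countable_topology}, 'e::euclidean_space) chart set"
  assumes atlas: "smooth_structure A"
begin

lemma is_chart: "c \<in> A \<Longrightarrow> is_chart c"
  and charts_cover: "(\<Union>c\<in>A. fst c) = UNIV"
  and compatible: "c \<in> A \<Longrightarrow> d \<in> A \<Longrightarrow> compatible c d"
  using atlas unfolding smooth_structure_def by blast+

lemma homeomorphism_chart:
  "c \<in> A \<Longrightarrow> homeomorphism (fst c) (snd c ` fst c) (snd c) (chart_inv c)"
  using is_chart by (simp add: is_chart_def)

lemma open_chart_domain: "c \<in> A \<Longrightarrow> open (fst c)"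
  using is_chart by (simp add: is_chart_def)

lemma ex_chart: "\<exists>c. c \<in> A \<and> p \<in> fst c"
  using charts_cover by blast

lemma chart_inv_chart: "c \<in> A \<Longrightarrow> q \<in> fst c \<Longrightarrow> chart_inv c (snd c q) = q"
  using homeomorphism_chart by (auto simp: homeomorphism_def)

lemma chart_chart_inv:
  assumes "c \<in> A" "x \<in> snd c ` fst c"
  shows "snd c (chart_inv c x) = x" "chart_inv c x \<in> fst c"
  using assms(2) chart_inv_chart[OF assms(1)] by auto

lemma open_chart_image:
  assumes "c \<in> A" "open U"
  shows "open (snd c ` (U \<inter> fst c))"
proof -
  have "snd c ` (U \<inter> fst c) = snd c ` fst c \<inter> chart_inv c -` U"
    using chart_inv_chart[OF assms(1)] by force
  moreover have "open (snd c ` fst c)"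
    using is_chart[OF assms(1)] by (simp add: is_chart_def)
  moreover have "continuous_on (snd c ` fst c) (chart_inv c)"
    using homeomorphism_chart[OF assms(1)] by (simp add: homeomorphism_def)
  ultimately show ?thesis
    using assms(2) continuous_open_preimage by metis
qed

lemma open_chart_preimage:
  assumes "c \<in> A" "open S"
  shows "open {q \<in> fst c. snd c q \<in> S}"
proof -
  have "{q \<in> fst c. snd c q \<in> S} = fst c \<inter> snd c -` S" by auto
  then show ?thesis
    using assms open_chart_domain[OF assms(1)] homeomorphism_chart[OF assms(1)]
      continuous_open_preimage[of "fst c" "snd c" S] by (simp add: homeomorphism_def)
qed

abbreviation jacobian :: "('m, 'e) chart \<Rightarrow> ('m, 'e) chart \<Rightarrow> 'm \<Rightarrow> 'e \<Rightarrow> 'e" where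
  "jacobian c d q \<equiv> frechet_derivative (snd d \<circ> chart_inv c) (at (snd c q))"

lemma transition_smooth:
  "c \<in> A \<Longrightarrow> d \<in> A \<Longrightarrow> smooth_on (snd c ` (fst c \<inter> fst d)) (snd d \<circ> chart_inv c)"
  using compatible by (simp add: compatible_def)

lemma transition_has_derivative:
  assumes "c \<in> A" "d \<in> A" "p \<in> fst c" "p \<in> fst d"
  shows "(snd d \<circ> chart_inv c has_derivative jacobian c d p) (at (snd c p))"
  using assms by (intro smooth_on_has_derivative[OF transition_smooth]) auto

text \<open>The chain rule for \<open>f \<circ> c\<^sup>-\<^sup>1 = (f \<circ> d\<^sup>-\<^sup>1) \<circ> (d \<circ> c\<^sup>-\<^sup>1)\<close>. It gives both the independence of \<open>deriv_along\<close> of the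
  chart and, for \<open>f = e\<close> a third chart, the cocycle identity of the Jacobians.\<close>

lemma has_derivative_change_chart:
  assumes "c \<in> A" "d \<in> A" "p \<in> fst c" "p \<in> fst d"
    and "(f \<circ> chart_inv d has_derivative f') (at (snd d p))"
  shows "(f \<circ> chart_inv c has_derivative (\<lambda>v. f' (jacobian c d p v))) (at (snd c p))"
proof (rule has_derivative_transform_within_open)
  have "(f \<circ> chart_inv d has_derivative f') (at ((snd d \<circ> chart_inv c) (snd c p)))"
    using assms(3,5) chart_inv_chart[OF assms(1)] by simp
  from has_derivative_compose[OF transition_has_derivative[OF assms(1-4)] this]
  show "((\<lambda>x. (f \<circ> chart_inv d) ((snd d \<circ> chart_inv c) x)) has_derivative
      (\<lambda>v. f' (jacobian c d p v))) (at (snd c p))" .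
  show "open (snd c ` (fst d \<inter> fst c))"
    using assms open_chart_image open_chart_domain by blast
qed (use assms(3,4) chart_inv_chart[OF assms(1)] chart_inv_chart[OF assms(2)] in auto)

lemma jacobian_cocycle:
  assumes "c \<in> A" "d \<in> A" "e \<in> A" "p \<in> fst c" "p \<in> fst d" "p \<in> fst e"
  shows "jacobian c e p v = jacobian d e p (jacobian c d p v)"
  by (rule fun_cong[OF frechet_derivative_at[OF has_derivative_change_chart[OF assms(1,2,4,5)
      transition_has_derivative[OF assms(2,3,5,6)]], symmetric]])

lemma jacobian_self:
  assumes "c \<in> A" "p \<in> fst c"
  shows "jacobian c c p v = v"
proof -
  have "(snd c \<circ> chart_inv c has_derivative (\<lambda>v. v)) (at (snd c p))"
    using open_chart_image[OF assms(1) open_UNIV] assms chart_chart_inv[OF assms(1)]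
    by (intro has_derivative_transform_within_open[OF has_derivative_ident, of "snd c ` fst c"])
      auto
  then show ?thesis by (simp only: frechet_derivative_at[symmetric])
qed

lemma linear_jacobian:
  assumes "c \<in> A" "d \<in> A" "p \<in> fst c" "p \<in> fst d"
  shows "linear (jacobian c d p)"
  using transition_has_derivative[OF assms] has_derivative_linear by blast

lemma tangent_spaceI:
  assumes "\<And>c. \<not> (c \<in> A \<and> p \<in> fst c) \<Longrightarrow> v c = 0"
    and "\<And>c d. c \<in> A \<Longrightarrow> d \<in> A \<Longrightarrow> p \<in> fst c \<Longrightarrow> p \<in> fst d \<Longrightarrow> v d = jacobian c d p (v c)"
  shows "v \<in> tangent_space A p"
  unfolding tangent_space_def using assms by blast

lemma tangent_space_outside:
  "v \<in> tangent_space A p \<Longrightarrow> \<not> (c \<in> A \<and> p \<in> fst c) \<Longrightarrow> v c = 0"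
  unfolding tangent_space_def by blast

lemma tangent_space_jacobian:
  assumes "v \<in> tangent_space A p" "c \<in> A" "d \<in> A" "p \<in> fst c" "p \<in> fst d"
  shows "v d = jacobian c d p (v c)"
  using assms unfolding tangent_space_def by blast

lemma tangent_space_add:
  assumes "u \<in> tangent_space A p" "v \<in> tangent_space A p"
  shows "u + v \<in> tangent_space A p"
proof (rule tangent_spaceI)
  fix c d assume cd: "c \<in> A" "d \<in> A" "p \<in> fst c" "p \<in> fst d"
  show "(u + v) d = jacobian c d p ((u + v) c)"
    using tangent_space_jacobian[OF assms(1) cd] tangent_space_jacobian[OF assms(2) cd]
    by (simp only: plus_fun_apply linear_add[OF linear_jacobian[OF cd]])
qed (simp add: tangent_space_outside[OF assms(1)] tangent_space_outside[OF assms(2)])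

lemma tangent_space_scaleR:
  assumes "v \<in> tangent_space A p"
  shows "r *\<^sub>R v \<in> tangent_space A p"
proof (rule tangent_spaceI)
  fix c d assume cd: "c \<in> A" "d \<in> A" "p \<in> fst c" "p \<in> fst d"
  show "(r *\<^sub>R v) d = jacobian c d p ((r *\<^sub>R v) c)"
    using tangent_space_jacobian[OF assms cd]
    by (simp only: scaleR_fun_def linear_cmul[OF linear_jacobian[OF cd]])
qed (simp add: tangent_space_outside[OF assms] scaleR_fun_def)

lemma tangent_space_zero: "0 \<in> tangent_space A p"
  by (rule tangent_spaceI) (simp_all add: linear_0[OF linear_jacobian])

lemma subspace_tangent_space: "subspace (tangent_space A p)"
  by (simp add: subspace_def tangent_space_zero tangent_space_add tangent_space_scaleR)

lemma tangent_space_eqI: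
  assumes "u \<in> tangent_space A p" "v \<in> tangent_space A p" "c \<in> A" "p \<in> fst c" "u c = v c"
  shows "u = v"
proof
  fix d
  show "u d = v d"
  proof (cases "d \<in> A \<and> p \<in> fst d")
    case True
    then show ?thesis
      using assms(5) tangent_space_jacobian[OF assms(1,3) _ assms(4)]
        tangent_space_jacobian[OF assms(2,3) _ assms(4)] by simp
  next
    case False
    then show ?thesis
      by (simp add: tangent_space_outside[OF assms(1)] tangent_space_outside[OF assms(2)])
  qed
qed

text \<open>By the cocycle identity, one coordinate vector determines a tangent vector.\<close>

definition tangent_vector :: "('m, 'e) chart \<Rightarrow> 'm \<Rightarrow> 'e \<Rightarrow> ('m, 'e) tvec" where
  "tangent_vector c p v = (\<lambda>d. if d \<in> A \<and> p \<in> fst d then jacobian c d p v else 0)"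

lemma tangent_vector_in:
  assumes "c \<in> A" "p \<in> fst c"
  shows "tangent_vector c p v \<in> tangent_space A p"
proof (rule tangent_spaceI)
  fix d e assume "d \<in> A" "e \<in> A" "p \<in> fst d" "p \<in> fst e"
  then show "tangent_vector c p v e = jacobian d e p (tangent_vector c p v d)"
    using jacobian_cocycle[of c d e p v] assms by (simp only: tangent_vector_def if_True simp_thms)
qed (simp only: tangent_vector_def if_False)

lemma tangent_vector_coord: "c \<in> A \<Longrightarrow> p \<in> fst c \<Longrightarrow> tangent_vector c p v c = v"
  by (simp add: tangent_vector_def jacobian_self)

lemma tangent_vector_eq:
  "c \<in> A \<Longrightarrow> p \<in> fst c \<Longrightarrow> v \<in> tangent_space A p \<Longrightarrow> tangent_vector c p (v c) = v"
  by (rule tangent_space_eqI[of _ p _ c]) (auto simp: tangent_vector_in tangent_vector_coord)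

text \<open>In another chart \<open>d\<close>, the components are products of the components in the chart \<open>c\<close> with
  entries of the Jacobian of the coordinate change.\<close>

lemma vector_field_on_chart:
  assumes c: "c \<in> A" and S: "open S" "S \<subseteq> snd c ` fst c" and F: "smooth_on S F"
  defines "U \<equiv> {q \<in> fst c. snd c q \<in> S}"
  shows "vector_field_on A U (\<lambda>q. tangent_vector c q (F (snd c q)))"
  unfolding vector_field_on_def
proof (intro conjI ballI)
  show "tangent_vector c p (F (snd c p)) \<in> tangent_space A p" if "p \<in> U" for p
    using that c by (simp add: U_def tangent_vector_in)
next
  fix d assume d: "d \<in> A"
  let ?T = "snd d ` (U \<inter> fst d)" and ?t = "snd c \<circ> chart_inv d"
  let ?D = "\<lambda>x. frechet_derivative (snd d \<circ> chart_inv c) (at x)"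
  have T: "open ?T"
    unfolding U_def by (rule open_chart_image[OF d open_chart_preimage[OF c S(1)]])
  have t: "smooth_on ?T ?t"
    by (rule smooth_on_subset[OF transition_smooth[OF d c]]) (auto simp: U_def)
  have tS: "?t ` ?T \<subseteq> S" "?t ` ?T \<subseteq> snd c ` (fst c \<inter> fst d)"
    using chart_inv_chart[OF d] by (auto simp: U_def)
  have "smooth_on ?T (\<lambda>x. F (?t x))"
    by (rule smooth_on_compose[OF T t F tS(1)])
  then have "smooth_on ?T (\<lambda>x. F (?t x) \<bullet> b)" for b
    by (rule smooth_on_bounded_linear[OF T bounded_linear_inner_left])
  moreover have "smooth_on ?T (\<lambda>x. ?D (?t x) b)" for b
    by (rule smooth_on_compose[OF T t smooth_on_frechet_derivative[OF transition_smooth[OF c d]] tS(2)])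
  ultimately have "smooth_on ?T (\<lambda>x. \<Sum>b\<in>Basis. (F (?t x) \<bullet> b) *\<^sub>R ?D (?t x) b)"
    by (intro smooth_on_sum smooth_on_scaleR T)
  then show "smooth_on ?T (\<lambda>x. tangent_vector c (chart_inv d x) (F (snd c (chart_inv d x))) d)"
  proof (rule smooth_on_cong[OF T, rotated])
    fix x assume "x \<in> ?T"
    then obtain q where q: "q \<in> U" "q \<in> fst d" "x = snd d q" by auto
    then have "q \<in> fst c" by (simp add: U_def)
    then have "linear (jacobian c d q)" using q c d by (intro linear_jacobian)
    from linear_expand_Basis[OF this, of "F (snd c q)"]
    show "(\<Sum>b\<in>Basis. (F (?t x) \<bullet> b) *\<^sub>R ?D (?t x) b) =
        tangent_vector c (chart_inv d x) (F (snd c (chart_inv d x))) d"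
      using q d by (simp add: tangent_vector_def chart_inv_chart)
  qed
qed

text \<open>Constant components in a chart give enough local fields to test identities of tensors against
  arbitrary tangent vectors.\<close>

lemma ex_vector_field:
  assumes "v \<in> tangent_space A p"
  shows "\<exists>U V. open U \<and> p \<in> U \<and> vector_field_on A U V \<and> V p = v"
proof -
  obtain c where c: "c \<in> A" "p \<in> fst c" using ex_chart by blast
  let ?S = "snd c ` fst c"
  have S: "open ?S" using open_chart_image[OF c(1) open_UNIV] by simp
  show ?thesis
  proof (intro exI conjI)
    show "vector_field_on A {q \<in> fst c. snd c q \<in> ?S} (\<lambda>q. tangent_vector c q (v c))"
      by (rule vector_field_on_chart[OF c(1) S order_refl smooth_on_const])
  qed (use c assms open_chart_preimage[OF c(1) S] tangent_vector_eq in auto)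
qed

lemma vector_field_on_subset: "vector_field_on A U V \<Longrightarrow> T \<subseteq> U \<Longrightarrow> vector_field_on A T V"
  unfolding vector_field_on_def by (blast intro: smooth_on_subset)

lemma vector_field_onD: "vector_field_on A U V \<Longrightarrow> p \<in> U \<Longrightarrow> V p \<in> tangent_space A p"
  by (simp add: vector_field_on_def)

lemma vector_field_on_add:
  assumes "open U" "vector_field_on A U V" "vector_field_on A U W"
  shows "vector_field_on A U (\<lambda>q. V q + W q)"
  using assms open_chart_image[OF _ assms(1)]
  by (auto simp: vector_field_on_def intro: tangent_space_add smooth_on_add)

lemma vector_field_on_scaleR:
  assumes "open U" "vector_field_on A U V"
  shows "vector_field_on A U (\<lambda>q. r *\<^sub>R V q)"
  using assms open_chart_image[OF _ assms(1)]
  by (auto simp: vector_field_on_def scaleR_fun_def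
      intro: tangent_space_scaleR smooth_on_bounded_linear[OF _ bounded_linear_scaleR_right]
        tangent_space_scaleR[unfolded scaleR_fun_def])


section \<open>Derivatives of functions along tangent vectors\<close>

lemma smooth_fun_on_add:
  assumes "open U" "smooth_fun_on A U f" "smooth_fun_on A U g"
  shows "smooth_fun_on A U (\<lambda>q. f q + g q)"
  using assms open_chart_image[OF _ assms(1)]
  by (auto simp: smooth_fun_on_def o_def intro: smooth_on_add)

lemma smooth_fun_on_mult:
  assumes "open U" "smooth_fun_on A U f" "smooth_fun_on A U g"
  shows "smooth_fun_on A U (\<lambda>q. f q * g q)"
  using assms open_chart_image[OF _ assms(1)]
  by (auto simp: smooth_fun_on_def o_def intro: smooth_on_scaleR[where 'b = real, simplified])

lemma smooth_fun_on_const: "smooth_fun_on A U (\<lambda>q. r)"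
  by (simp add: smooth_fun_on_def o_def smooth_on_const)

lemma deriv_along_has_derivative:
  assumes "p \<in> U" "smooth_fun_on A U f" "v \<in> tangent_space A p" "c \<in> A" "p \<in> fst c"
  obtains f' where "(f \<circ> chart_inv c has_derivative f') (at (snd c p))"
    and "deriv_along A p v f = f' (v c)"
proof -
  define d where "d = (SOME d. d \<in> A \<and> p \<in> fst d)"
  have d: "d \<in> A" "p \<in> fst d" using someI_ex[OF ex_chart[of p]] by (auto simp: d_def)
  have "(f \<circ> chart_inv d has_derivative frechet_derivative (f \<circ> chart_inv d) (at (snd d p)))
      (at (snd d p))"
    using assms d by (intro smooth_on_has_derivative[of "snd d ` (U \<inter> fst d)"])
      (auto simp: smooth_fun_on_def)
  from has_derivative_change_chart[OF assms(4) d(1) assms(5) d(2) this] show ?thesis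
    using that tangent_space_jacobian[OF assms(3,4) d(1) assms(5) d(2)]
    by (simp add: deriv_along_def Let_def flip: d_def)
qed

lemma deriv_along_eq:
  assumes "p \<in> U" "smooth_fun_on A U f" "v \<in> tangent_space A p" "c \<in> A" "p \<in> fst c"
    and "(f \<circ> chart_inv c has_derivative f') (at (snd c p))"
  shows "deriv_along A p v f = f' (v c)"
  using deriv_along_has_derivative[OF assms(1-5)] has_derivative_unique[OF assms(6)] by metis

lemma deriv_along_add:
  assumes "open U" "p \<in> U" "smooth_fun_on A U f" "smooth_fun_on A U g" "v \<in> tangent_space A p"
  shows "deriv_along A p v (\<lambda>q. f q + g q) = deriv_along A p v f + deriv_along A p v g"
proof -
  obtain c where c: "c \<in> A" "p \<in> fst c" using ex_chart by blast
  obtain f' where f': "(f \<circ> chart_inv c has_derivative f') (at (snd c p))"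
      "deriv_along A p v f = f' (v c)"
    by (rule deriv_along_has_derivative[OF assms(2,3,5) c])
  obtain g' where g': "(g \<circ> chart_inv c has_derivative g') (at (snd c p))"
      "deriv_along A p v g = g' (v c)"
    by (rule deriv_along_has_derivative[OF assms(2,4,5) c])
  have "((\<lambda>q. f q + g q) \<circ> chart_inv c has_derivative (\<lambda>v. f' v + g' v)) (at (snd c p))"
    using has_derivative_add[OF f'(1) g'(1)] by (simp add: o_def)
  from deriv_along_eq[OF assms(2) smooth_fun_on_add[OF assms(1,3,4)] assms(5) c this]
  show ?thesis using f' g' by simp
qed

lemma deriv_along_mult:
  assumes "open U" "p \<in> U" "smooth_fun_on A U f" "smooth_fun_on A U g" "v \<in> tangent_space A p"
  shows "deriv_along A p v (\<lambda>q. f q * g q) =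
    f p * deriv_along A p v g + deriv_along A p v f * g p"
proof -
  obtain c where c: "c \<in> A" "p \<in> fst c" using ex_chart by blast
  obtain f' where f': "(f \<circ> chart_inv c has_derivative f') (at (snd c p))"
      "deriv_along A p v f = f' (v c)"
    by (rule deriv_along_has_derivative[OF assms(2,3,5) c])
  obtain g' where g': "(g \<circ> chart_inv c has_derivative g') (at (snd c p))"
      "deriv_along A p v g = g' (v c)"
    by (rule deriv_along_has_derivative[OF assms(2,4,5) c])
  have "((\<lambda>q. f q * g q) \<circ> chart_inv c has_derivative (\<lambda>v. f p * g' v + f' v * g p)) (at (snd c p))"
    using has_derivative_mult[OF f'(1) g'(1)] c by (simp add: o_def chart_inv_chart)
  from deriv_along_eq[OF assms(2) smooth_fun_on_mult[OF assms(1,3,4)] assms(5) c this]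
  show ?thesis using f' g' by simp
qed

lemma deriv_along_const: "deriv_along A p v (\<lambda>q. r) = 0"
  by (simp add: deriv_along_def Let_def o_def frechet_derivative_const)


section \<open>Hypersurfaces\<close>

text \<open>In a slice chart, a vector tangent to \<open>H\<close> is the velocity of a straight line in the coordinate
  hyperplane, and the line stays in \<open>H\<close> for a short time.\<close>

lemma deriv_along_const_on_hypersurface:
  assumes U: "open U" "p \<in> U" and f: "smooth_fun_on A U f"
    and p: "p \<in> H" and v: "v \<in> hyp_tangent_space A H p"
    and const: "\<And>q. q \<in> U \<Longrightarrow> q \<in> H \<Longrightarrow> f q = r"
  shows "deriv_along A p v f = 0"
proof -
  obtain b c where c: "slice_chart A H b c" "p \<in> fst c" "v c \<bullet> b = 0"
    and vT: "v \<in> tangent_space A p"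
    using v by (auto simp: hyp_tangent_space_def)
  then have cA: "c \<in> A"
    and slice: "snd c ` (fst c \<inter> H) = snd c ` fst c \<inter> {x. x \<bullet> b = 0}"
    by (auto simp: slice_chart_def)
  obtain f' where f': "(f \<circ> chart_inv c has_derivative f') (at (snd c p))"
      "deriv_along A p v f = f' (v c)"
    by (rule deriv_along_has_derivative[OF U(2) f vT cA c(2)])
  let ?l = "\<lambda>t::real. snd c p + t *\<^sub>R v c" and ?S = "snd c ` (U \<inter> fst c)"
  have l: "(?l has_derivative (\<lambda>t. t *\<^sub>R v c)) (at 0)"
    by (auto intro!: derivative_eq_intros)
  have "(f \<circ> chart_inv c has_derivative f') (at (?l 0))" using f'(1) by simp
  from has_derivative_compose[OF l this]
  have 1: "((\<lambda>t. (f \<circ> chart_inv c) (?l t)) has_derivative (\<lambda>t. f' (t *\<^sub>R v c))) (at 0)" .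
  have 2: "((\<lambda>t. (f \<circ> chart_inv c) (?l t)) has_derivative (\<lambda>t. 0)) (at 0)"
  proof (rule has_derivative_transform_within_open[OF has_derivative_const])
    have "continuous_on UNIV ?l" by (intro continuous_intros)
    then show "open (?l -` ?S)"
      by (intro open_vimage open_chart_image[OF cA U(1)])
    show "0 \<in> ?l -` ?S" using U c by simp
    fix t assume "t \<in> ?l -` ?S"
    then have S: "?l t \<in> ?S" by simp
    have "snd c p \<bullet> b = 0" using slice c(2) p by blast
    then have "?l t \<in> snd c ` fst c \<inter> {x. x \<bullet> b = 0}"
      using S c(3) by (auto simp: inner_add_left)
    then obtain q where q: "q \<in> fst c" "q \<in> H" "?l t = snd c q" using slice by blast
    moreover obtain q' where "q' \<in> U" "q' \<in> fst c" "?l t = snd c q'" using S by blast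
    ultimately have "q \<in> U" using chart_inv_chart[OF cA] by metis
    then show "r = (f \<circ> chart_inv c) (?l t)"
      using q const chart_inv_chart[OF cA] by simp
  qed
  show ?thesis
    using fun_cong[OF has_derivative_unique[OF 1 2], of 1] f'(2) by simp
qed

text \<open>The function \<open>q \<mapsto> snd c q \<bullet> b\<close> vanishes on \<open>H\<close>, so a vector tangent to \<open>H\<close> according to some
  slice chart satisfies the linear equation of every other one.\<close>

lemma hyp_tangent_space_iff:
  assumes c: "slice_chart A H b c" "p \<in> fst c" and p: "p \<in> H"
  shows "v \<in> hyp_tangent_space A H p \<longleftrightarrow> v \<in> tangent_space A p \<and> v c \<bullet> b = 0"
proof
  assume v: "v \<in> hyp_tangent_space A H p"
  then have vT: "v \<in> tangent_space A p" by (simp add: hyp_tangent_space_def)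
  have cA: "c \<in> A" using c by (simp add: slice_chart_def)
  let ?f = "\<lambda>q. snd c q \<bullet> b"
  have smooth: "smooth_fun_on A (fst c) ?f"
    unfolding smooth_fun_on_def
  proof
    fix d assume d: "d \<in> A"
    have "smooth_on (snd d ` (fst c \<inter> fst d)) (\<lambda>x. (snd c \<circ> chart_inv d) x \<bullet> b)"
      using transition_smooth[OF d cA] open_chart_image[OF d open_chart_domain[OF cA]]
      by (intro smooth_on_bounded_linear[OF _ bounded_linear_inner_left]) (simp_all add: Int_commute o_def)
    then show "smooth_on (snd d ` (fst c \<inter> fst d)) (?f \<circ> chart_inv d)" by (simp add: o_def)
  qed
  have "((\<lambda>x. (snd c \<circ> chart_inv c) x \<bullet> b) has_derivative (\<lambda>v. jacobian c c p v \<bullet> b)) (at (snd c p))"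
    by (rule has_derivative_inner_left[OF transition_has_derivative[OF cA cA c(2) c(2)]])
  then have "(?f \<circ> chart_inv c has_derivative (\<lambda>v. jacobian c c p v \<bullet> b)) (at (snd c p))"
    by (simp add: o_def)
  from deriv_along_eq[OF c(2) smooth vT cA c(2) this]
  have "deriv_along A p v ?f = v c \<bullet> b" by (simp add: jacobian_self[OF cA c(2)])
  moreover have "deriv_along A p v ?f = 0"
  proof (rule deriv_along_const_on_hypersurface[OF open_chart_domain[OF cA] c(2) smooth p v])
    show "q \<in> fst c \<Longrightarrow> q \<in> H \<Longrightarrow> snd c q \<bullet> b = 0" for q
      using c(1) unfolding slice_chart_def by blast
  qed
  ultimately show "v \<in> tangent_space A p \<and> v c \<bullet> b = 0" using vT by simp
qed (use c in \<open>unfold hyp_tangent_space_def, blast\<close>)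

lemma hyp_tangent_space_subset: "v \<in> hyp_tangent_space A H p \<Longrightarrow> v \<in> tangent_space A p"
  by (simp add: hyp_tangent_space_def)

lemma subspace_hyp_tangent_space:
  assumes "hypersurface A H" "p \<in> H"
  shows "subspace (hyp_tangent_space A H p)"
proof -
  obtain b c where "slice_chart A H b c" "p \<in> fst c"
    using assms by (auto simp: hypersurface_def)
  from hyp_tangent_space_iff[OF this assms(2)] show ?thesis
    using subspace_tangent_space[of p]
    by (simp add: subspace_def inner_add_left scaleR_fun_def)
qed

text \<open>The component transverse to \<open>H\<close> in a slice chart shows that \<open>H\<close> has codimension one.\<close>

lemma hyp_tangent_space_complement:
  assumes "hypersurface A H" "p \<in> H"
    and n: "n \<in> tangent_space A p" "n \<notin> hyp_tangent_space A H p" and w: "w \<in> tangent_space A p"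
  obtains t where "w - t *\<^sub>R n \<in> hyp_tangent_space A H p"
proof -
  obtain b c where c: "slice_chart A H b c" "p \<in> fst c"
    using assms by (auto simp: hypersurface_def)
  note iff = hyp_tangent_space_iff[OF c assms(2)]
  have "n c \<bullet> b \<noteq> 0" using n iff by simp
  then have "(w - ((w c \<bullet> b) / (n c \<bullet> b)) *\<^sub>R n) c \<bullet> b = 0"
    by (simp add: scaleR_fun_def inner_diff_left)
  moreover have "w - r *\<^sub>R n \<in> tangent_space A p" for r
    using n w subspace_tangent_space by (simp add: subspace_diff subspace_scale)
  ultimately show ?thesis using that iff by blast
qed

text \<open>The extension is constant along the direction transverse to \<open>H\<close> of a slice chart.\<close>

lemma ex_extension:
  assumes "hypersurface A H" "p \<in> H" "hyp_vector_field A H V"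
  shows "\<exists>U W. open U \<and> p \<in> U \<and> vector_field_on A U W \<and> (\<forall>q\<in>U \<inter> H. W q = V q)"
proof -
  obtain b c where c: "slice_chart A H b c" "p \<in> fst c"
    using assms by (auto simp: hypersurface_def)
  then have cA: "c \<in> A"
    and slice: "\<And>q. q \<in> fst c \<Longrightarrow> q \<in> H \<Longrightarrow> snd c q \<bullet> b = 0"
    unfolding slice_chart_def by blast+
  let ?pr = "\<lambda>x. x - (x \<bullet> b) *\<^sub>R b"
  let ?F = "\<lambda>x. V (chart_inv c (?pr x)) c"
  define S where "S = snd c ` fst c \<inter> ?pr -` (snd c ` fst c)"
  define U where "U = {q \<in> fst c. snd c q \<in> S}"
  have "open (snd c ` fst c)" using open_chart_image[OF cA open_UNIV] by simp
  then have S: "open S" unfolding S_def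
    by (intro open_Int open_vimage) (auto intro!: continuous_intros)
  have "smooth_on S ?F"
    using assms(3) c(1) unfolding hyp_vector_field_def S_def
    by (blast intro: smooth_on_subset)
  from vector_field_on_chart[OF cA S _ this]
  have "vector_field_on A U (\<lambda>q. tangent_vector c q (?F (snd c q)))"
    by (simp add: U_def S_def)
  moreover have "open U" unfolding U_def by (rule open_chart_preimage[OF cA S])
  moreover have "p \<in> U" using c(2) assms(2) slice by (simp add: U_def S_def)
  moreover have "tangent_vector c q (?F (snd c q)) = V q" if "q \<in> U \<inter> H" for q
    using that assms(3) slice tangent_vector_eq[OF cA, of q "V q"]
    by (simp add: U_def chart_inv_chart[OF cA] hyp_vector_field_def hyp_tangent_space_def)
  ultimately show ?thesis by blast
qed


section \<open>Metrics and connections\<close>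

lemma
  assumes "smooth_symmetric_tensor A g"
  shows tensor_sym: "u \<in> tangent_space A p \<Longrightarrow> v \<in> tangent_space A p \<Longrightarrow> g p u v = g p v u"
    and tensor_add_left: "u \<in> tangent_space A p \<Longrightarrow> v \<in> tangent_space A p \<Longrightarrow>
      w \<in> tangent_space A p \<Longrightarrow> g p (u + v) w = g p u w + g p v w"
    and tensor_scaleR_left: "u \<in> tangent_space A p \<Longrightarrow> w \<in> tangent_space A p \<Longrightarrow>
      g p (r *\<^sub>R u) w = r * g p u w"
    and tensor_smooth: "open U \<Longrightarrow> vector_field_on A U X \<Longrightarrow> vector_field_on A U Y \<Longrightarrow>
      smooth_fun_on A U (\<lambda>q. g q (X q) (Y q))"
  using assms by (simp_all add: smooth_symmetric_tensor_def)

lemma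
  assumes g: "smooth_symmetric_tensor A g"
    and u: "u \<in> tangent_space A p" and v: "v \<in> tangent_space A p"
  shows tensor_add_right: "w \<in> tangent_space A p \<Longrightarrow> g p u (v + w) = g p u v + g p u w"
    and tensor_scaleR_right: "g p u (r *\<^sub>R v) = r * g p u v"
    and tensor_diff_left: "w \<in> tangent_space A p \<Longrightarrow> g p (u - v) w = g p u w - g p v w"
proof -
  note sym = tensor_sym[OF g u]
  show "g p u (v + w) = g p u v + g p u w" if w: "w \<in> tangent_space A p"
    using tensor_add_left[OF g v w u] sym[OF tangent_space_add[OF v w]] sym[OF v] sym[OF w] by simp
  show "g p u (r *\<^sub>R v) = r * g p u v"
    using tensor_scaleR_left[OF g v u] sym[OF tangent_space_scaleR[OF v]] sym[OF v] by simp
  have "u - v \<in> tangent_space A p" using subspace_diff[OF subspace_tangent_space u v] .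
  from tensor_add_left[OF g this v] show "g p (u - v) w = g p u w - g p v w"
    if "w \<in> tangent_space A p" using that by simp
qed

lemma tensor_zero_left:
  "smooth_symmetric_tensor A g \<Longrightarrow> w \<in> tangent_space A p \<Longrightarrow> g p 0 w = 0"
  using tensor_scaleR_left[of g 0 p w 0] by (simp add: tangent_space_zero)

lemma tensor_sum_left:
  assumes g: "smooth_symmetric_tensor A g"
    and e: "\<And>i. i \<in> I \<Longrightarrow> e i \<in> tangent_space A p" and w: "w \<in> tangent_space A p"
  shows "g p (\<Sum>i\<in>I. y i *\<^sub>R e i) w = (\<Sum>i\<in>I. y i * g p (e i) w)"
  using e
proof (induction I rule: infinite_finite_induct)
  case (insert i I)
  have "(\<Sum>i\<in>I. y i *\<^sub>R e i) \<in> tangent_space A p"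
    using insert.prems by (intro subspace_sum[OF subspace_tangent_space] tangent_space_scaleR) simp
  then have "g p (y i *\<^sub>R e i + (\<Sum>i\<in>I. y i *\<^sub>R e i)) w =
      y i * g p (e i) w + g p (\<Sum>i\<in>I. y i *\<^sub>R e i) w"
    using insert.prems tensor_add_left[OF g tangent_space_scaleR _ w]
      tensor_scaleR_left[OF g _ w] by simp
  moreover have "g p (\<Sum>i\<in>I. y i *\<^sub>R e i) w = (\<Sum>i\<in>I. y i * g p (e i) w)"
    using insert.prems by (intro insert.IH) simp
  ultimately show ?case by (simp only: sum.insert[OF insert.hyps(1,2)])
qed (simp_all add: tensor_zero_left[OF g w])

lemma canonical_variation_eq:
  "canonical_variation g E p u v = g p u v + 2 * (g p (E p) u * g p (E p) v)"
  by (simp add: canonical_variation_def Let_def)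

lemma smooth_symmetric_tensor_canonical_variation:
  assumes g: "smooth_symmetric_tensor A g" and E: "vector_field_on A UNIV E"
  shows "smooth_symmetric_tensor A (canonical_variation g E)"
proof -
  have ET: "E p \<in> tangent_space A p" for p using vector_field_onD[OF E] by simp
  show ?thesis
    unfolding smooth_symmetric_tensor_def canonical_variation_eq
  proof (intro conjI allI ballI impI; (elim conjE)?)
    fix p u v assume uv: "u \<in> tangent_space A p" "v \<in> tangent_space A p"
    show "g p u v + 2 * (g p (E p) u * g p (E p) v) = g p v u + 2 * (g p (E p) v * g p (E p) u)"
      using tensor_sym[OF g uv] by simp
    fix w assume w: "w \<in> tangent_space A p"
    show "g p (u + v) w + 2 * (g p (E p) (u + v) * g p (E p) w) =
        g p u w + 2 * (g p (E p) u * g p (E p) w) + (g p v w + 2 * (g p (E p) v * g p (E p) w))"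
      by (simp add: tensor_add_left[OF g uv w] tensor_add_right[OF g ET uv] algebra_simps)
    show "g p (r *\<^sub>R u) w + 2 * (g p (E p) (r *\<^sub>R u) * g p (E p) w) =
        r * (g p u w + 2 * (g p (E p) u * g p (E p) w))" for r
      by (simp add: tensor_scaleR_left[OF g uv(1) w] tensor_scaleR_right[OF g ET uv(1)]
          algebra_simps)
  next
    fix U X Y assume U: "open U" and X: "vector_field_on A U X" and Y: "vector_field_on A U Y"
    note E' = vector_field_on_subset[OF E subset_UNIV]
    show "smooth_fun_on A U (\<lambda>p. g p (X p) (Y p) + 2 * (g p (E p) (X p) * g p (E p) (Y p)))"
      by (intro smooth_fun_on_add[OF U] smooth_fun_on_mult[OF U] smooth_fun_on_const
          tensor_smooth[OF g U X Y] tensor_smooth[OF g U E' X] tensor_smooth[OF g U E' Y])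
  qed
qed

lemma deriv_along_cong_on_hypersurface:
  assumes U: "open U" "p \<in> U" and f: "smooth_fun_on A U f" and h: "smooth_fun_on A U h"
    and p: "p \<in> H" and v: "v \<in> hyp_tangent_space A H p"
    and eq: "\<And>q. q \<in> U \<Longrightarrow> q \<in> H \<Longrightarrow> f q = h q"
  shows "deriv_along A p v f = deriv_along A p v h"
proof -
  note vT = hyp_tangent_space_subset[OF v]
  have mh: "smooth_fun_on A U (\<lambda>q. -1 * h q)"
    by (rule smooth_fun_on_mult[OF U(1) smooth_fun_on_const h])
  have "deriv_along A p v (\<lambda>q. f q + -1 * h q) = 0"
    by (rule deriv_along_const_on_hypersurface[OF U smooth_fun_on_add[OF U(1) f mh] p v])
      (simp add: eq)
  moreover have "deriv_along A p v (\<lambda>q. -1 * h q) = - deriv_along A p v h"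
    using deriv_along_mult[OF U smooth_fun_on_const h vT, of "-1"] by (simp add: deriv_along_const)
  ultimately show ?thesis using deriv_along_add[OF U f mh vT] by simp
qed

lemma
  assumes LC: "levi_civita A g nabla" and U: "open U" and p: "p \<in> U" and X: "vector_field_on A U X"
  shows nabla_in: "u \<in> tangent_space A p \<Longrightarrow> nabla p u X \<in> tangent_space A p"
    and nabla_add: "u \<in> tangent_space A p \<Longrightarrow> v \<in> tangent_space A p \<Longrightarrow>
      nabla p (u + v) X = nabla p u X + nabla p v X"
    and nabla_scaleR: "u \<in> tangent_space A p \<Longrightarrow> nabla p (r *\<^sub>R u) X = r *\<^sub>R nabla p u X"
    and nabla_torsion_free: "vector_field_on A U Y \<Longrightarrow>
      nabla p (X p) Y - nabla p (Y p) X = lie_bracket A X Y p"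
    and nabla_metric: "vector_field_on A U Y \<Longrightarrow> u \<in> tangent_space A p \<Longrightarrow>
      deriv_along A p u (\<lambda>q. g q (X q) (Y q)) = g p (nabla p u X) (Y p) + g p (X p) (nabla p u Y)"
proof -
  note LC' = LC[unfolded levi_civita_def affine_connection_def]
  note affine = conjunct1[OF LC', THEN spec[of _ U], THEN spec[of _ X], THEN mp,
      OF conjI[OF U X]]
  show "u \<in> tangent_space A p \<Longrightarrow> nabla p u X \<in> tangent_space A p"
    and "u \<in> tangent_space A p \<Longrightarrow> v \<in> tangent_space A p \<Longrightarrow>
      nabla p (u + v) X = nabla p u X + nabla p v X"
    and "u \<in> tangent_space A p \<Longrightarrow> nabla p (r *\<^sub>R u) X = r *\<^sub>R nabla p u X"
    using affine p by blast+
  note metric = conjunct2[OF LC', THEN spec[of _ U], THEN spec[of _ X], THEN spec[of _ Y], THEN mp]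
  show "vector_field_on A U Y \<Longrightarrow> nabla p (X p) Y - nabla p (Y p) X = lie_bracket A X Y p"
    and "vector_field_on A U Y \<Longrightarrow> u \<in> tangent_space A p \<Longrightarrow>
      deriv_along A p u (\<lambda>q. g q (X q) (Y q)) = g p (nabla p u X) (Y p) + g p (X p) (nabla p u Y)"
    using metric U p X by blast+
qed

definition nondegenerate :: "('m, 'e) tensor2 \<Rightarrow> bool" where
  "nondegenerate g \<longleftrightarrow>
    (\<forall>p. \<forall>u\<in>tangent_space A p. (\<forall>w\<in>tangent_space A p. g p u w = 0) \<longrightarrow> u = 0)"

text \<open>Since the connection is metric, \<open>g(\<nabla>\<^sub>u W, Z) = u(g(W, Z)) - g(W, \<nabla>\<^sub>u Z)\<close>, and for \<open>u\<close> tangent to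
  \<open>H\<close> the right-hand side only involves the values of \<open>W\<close> on \<open>H\<close>.\<close>

lemma nabla_cong_on_hypersurface:
  assumes g: "smooth_symmetric_tensor A g" "nondegenerate g" and LC: "levi_civita A g nabla"
    and p: "p \<in> H" and u: "u \<in> hyp_tangent_space A H p"
    and V: "open U" "p \<in> U" "vector_field_on A U V"
    and W: "open T" "p \<in> T" "vector_field_on A T W"
    and eq: "\<And>q. q \<in> U \<inter> T \<inter> H \<Longrightarrow> V q = W q"
  shows "nabla p u V = nabla p u W"
proof -
  note uT = hyp_tangent_space_subset[OF u]
  note nV = nabla_in[OF LC V uT] and nW = nabla_in[OF LC W uT]
  have "g p (nabla p u V - nabla p u W) w = 0" if w: "w \<in> tangent_space A p" for w
  proof -
    obtain Q Z where Q: "open Q" "p \<in> Q" and Z: "vector_field_on A Q Z" "Z p = w"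
      using ex_vector_field[OF w] by blast
    define S where "S = U \<inter> T \<inter> Q"
    have S: "open S" "p \<in> S" and V': "vector_field_on A S V" and W': "vector_field_on A S W"
      and Z': "vector_field_on A S Z"
      using V W Q Z by (auto simp: S_def intro: vector_field_on_subset)
    have "deriv_along A p u (\<lambda>q. g q (V q) (Z q)) = deriv_along A p u (\<lambda>q. g q (W q) (Z q))"
      by (rule deriv_along_cong_on_hypersurface[OF S tensor_smooth[OF g(1) S(1) V' Z']
            tensor_smooth[OF g(1) S(1) W' Z'] p u]) (simp add: eq S_def)
    moreover have "V p = W p" using eq V W p by simp
    ultimately have "g p (nabla p u V) w = g p (nabla p u W) w"
      using nabla_metric[OF LC S V' Z' uT] nabla_metric[OF LC S W' Z' uT] Z(2) by simp
    then show ?thesis using tensor_diff_left[OF g(1) nV nW w] by simp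
  qed
  then show ?thesis
    using g(2) subspace_diff[OF subspace_tangent_space nV nW] unfolding nondegenerate_def
    by fastforce
qed

text \<open>Hence the definite description in \<open>nabla_along\<close> may be evaluated on any extension.\<close>

lemma nabla_along_eq:
  assumes g: "smooth_symmetric_tensor A g" "nondegenerate g" and LC: "levi_civita A g nabla"
    and p: "p \<in> H" and u: "u \<in> hyp_tangent_space A H p"
    and W: "open U" "p \<in> U" "vector_field_on A U W" "\<And>q. q \<in> U \<inter> H \<Longrightarrow> W q = V q"
  shows "nabla_along A H nabla p u V = nabla p u W"
  unfolding nabla_along_def
proof (rule the_equality)
  show "\<forall>T Z. open T \<and> p \<in> T \<and> vector_field_on A T Z \<and> (\<forall>q\<in>T \<inter> H. Z q = V q) \<longrightarrow>
      nabla p u W = nabla p u Z"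
    using nabla_cong_on_hypersurface[OF g LC p u W(1-3)] W(4) by (metis IntD1 IntD2 IntI)
qed (use W in blast)

text \<open>Replacing the brackets by covariant derivatives, the terms \<open>\<nabla>\<^sub>E X\<close> and \<open>\<nabla>\<^sub>E Y\<close> cancel against
  those from \<open>E (g(X, Y))\<close>. What remains depends only on the values \<open>x\<close> and \<open>y\<close>.\<close>

lemma lie_derivative_eq:
  assumes g: "smooth_symmetric_tensor A g" and LC: "levi_civita A g nabla"
    and E: "vector_field_on A UNIV E"
    and x: "x \<in> tangent_space A p" and y: "y \<in> tangent_space A p"
  shows "lie_derivative A E g p x y = g p (nabla p x E) y + g p (nabla p y E) x"
  unfolding lie_derivative_def
proof (rule the_equality)
  have "g p (nabla p x E) y + g p (nabla p y E) x =
      deriv_along A p (E p) (\<lambda>q. g q (X q) (Y q))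
        - g p (lie_bracket A E X p) (Y p) - g p (X p) (lie_bracket A E Y p)"
    if U: "open U" "p \<in> U" and X: "vector_field_on A U X" and Y: "vector_field_on A U Y"
      and p: "X p = x" "Y p = y" for U X Y
  proof -
    have E': "vector_field_on A U E" using vector_field_on_subset[OF E] by simp
    note ET = vector_field_onD[OF E UNIV_I, of p]
    note nE = nabla_in[OF LC U E']
    note nX = nabla_in[OF LC U X ET] and nY = nabla_in[OF LC U Y ET]
    have "g p (lie_bracket A E X p) y = g p (nabla p (E p) X) y - g p (nabla p x E) y"
      using nabla_torsion_free[OF LC U E' X] p tensor_diff_left[OF g nX nE[OF x] y] by simp
    moreover have "g p x (lie_bracket A E Y p) = g p x (nabla p (E p) Y) - g p (nabla p y E) x"
      using nabla_torsion_free[OF LC U E' Y] p tensor_diff_left[OF g nY nE[OF y] x]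
        tensor_sym[OF g x] subspace_diff[OF subspace_tangent_space nY nE[OF y]] nY by simp
    ultimately show ?thesis using nabla_metric[OF LC U X Y ET] p by simp
  qed
  then show *: "\<forall>U X Y. open U \<and> p \<in> U \<and> vector_field_on A U X \<and> vector_field_on A U Y \<and>
      X p = x \<and> Y p = y \<longrightarrow> g p (nabla p x E) y + g p (nabla p y E) x =
      deriv_along A p (E p) (\<lambda>q. g q (X q) (Y q))
        - g p (lie_bracket A E X p) (Y p) - g p (X p) (lie_bracket A E Y p)"
    by blast
  obtain U X T Y where U: "open U" "p \<in> U" "vector_field_on A U X" "X p = x"
    and T: "open T" "p \<in> T" "vector_field_on A T Y" "Y p = y"
    using ex_vector_field[OF x] ex_vector_field[OF y] by blast
  have ext: "open (U \<inter> T) \<and> p \<in> U \<inter> T \<and> vector_field_on A (U \<inter> T) X \<and>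
      vector_field_on A (U \<inter> T) Y \<and> X p = x \<and> Y p = y"
    using U T by (auto intro: vector_field_on_subset)
  fix r
  assume "\<forall>U X Y. open U \<and> p \<in> U \<and> vector_field_on A U X \<and> vector_field_on A U Y \<and>
      X p = x \<and> Y p = y \<longrightarrow> r = deriv_along A p (E p) (\<lambda>q. g q (X q) (Y q))
        - g p (lie_bracket A E X p) (Y p) - g p (X p) (lie_bracket A E Y p)"
  from this[rule_format, OF ext] *[rule_format, OF ext]
  show "r = g p (nabla p x E) y + g p (nabla p y E) x" by (rule trans[OF _ sym])
qed


section \<open>Lorentzian linear algebra\<close>

text \<open>Orthogonal vectors with nonzero squares are linearly independent, and there are as many as the
  dimension \<open>DIM('e)\<close> of the tangent space.\<close>

lemma orthogonal_expansion:
  fixes e :: "'e \<Rightarrow> ('m, 'e) tvec" and s :: "'e \<Rightarrow> real"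
  assumes g: "smooth_symmetric_tensor A g"
    and e: "\<And>b. b \<in> Basis \<Longrightarrow> e b \<in> tangent_space A p"
    and orth: "\<And>b b'. b \<in> Basis \<Longrightarrow> b' \<in> Basis \<Longrightarrow> g p (e b) (e b') = (if b = b' then s b else 0)"
    and s: "\<And>b. s b \<noteq> 0"
    and x: "x \<in> tangent_space A p"
  obtains y where "x = (\<Sum>b\<in>Basis. y b *\<^sub>R e b)"
proof -
  obtain c where c: "c \<in> A" "p \<in> fst c" using ex_chart by blast
  define L where "L v = (\<Sum>b\<in>Basis. (v \<bullet> b) *\<^sub>R e b)" for v
  have coord: "(\<Sum>b\<in>B. f b *\<^sub>R e b) c = (\<Sum>b\<in>B. f b *\<^sub>R e b c)" for B f
    by (induction B rule: infinite_finite_induct) (simp_all add: scaleR_fun_def)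
  have LT: "L v \<in> tangent_space A p" for v
    unfolding L_def using e by (intro subspace_sum[OF subspace_tangent_space] tangent_space_scaleR)
  have lin: "linear (\<lambda>v. L v c)"
    unfolding L_def coord
    by (intro linear_compose_sum ballI linearI) (simp_all add: inner_add_left algebra_simps)
  have "inj (\<lambda>v. L v c)"
    unfolding linear_injective_0[OF lin]
  proof (intro allI impI)
    fix v assume "L v c = 0"
    then have "L v = 0"
      using tangent_space_eqI[OF LT tangent_space_zero c] by simp
    have "v \<bullet> b = 0" if b: "b \<in> Basis" for b
    proof -
      have "0 = g p (L v) (e b)"
        using \<open>L v = 0\<close> tensor_zero_left[OF g e[OF b]] by simp
      also have "\<dots> = (\<Sum>b'\<in>Basis. (v \<bullet> b') * g p (e b') (e b))"
        unfolding L_def by (rule tensor_sum_left[OF g e e[OF b]])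
      also have "\<dots> = (\<Sum>b'\<in>Basis. if b' = b then (v \<bullet> b) * s b else 0)"
        by (rule sum.cong) (auto simp: orth b)
      finally show ?thesis using b s[of b] by simp
    qed
    then show "v = 0" by (simp add: euclidean_eq_iff[of v 0])
  qed
  then have "surj (\<lambda>v. L v c)" using linear_injective_imp_surjective[OF lin] by simp
  then obtain v where "x c = L v c" by (metis surjD)
  then have "x = L v" by (rule tangent_space_eqI[OF x LT c])
  then show ?thesis using that unfolding L_def by blast
qed

text \<open>In an orthonormal basis with timelike member \<open>e\<^sub>0\<close>, write \<open>y\<close> and \<open>z\<close> for the components of \<open>t\<close> and \<open>x\<close>.
  Then \<open>y\<^sub>0 z\<^sub>0\<close> is the Euclidean product of the spacelike parts, and \<open>y\<^sub>0\<^sup>2 - 1\<close> is the squared length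
  of the spacelike part of \<open>t\<close>; the Cauchy-Schwarz inequality bounds \<open>z\<^sub>0\<^sup>2\<close> by the squared length of
  the spacelike part of \<open>x\<close>, strictly unless \<open>x = 0\<close>.\<close>

lemma timelike_perp_positive:
  assumes g: "lorentzian_metric A g"
    and t: "t \<in> tangent_space A p" "g p t t = -1"
    and x: "x \<in> tangent_space A p" "g p t x = 0" "x \<noteq> 0"
  shows "g p x x > 0"
proof -
  have gs: "smooth_symmetric_tensor A g" using g by (simp add: lorentzian_metric_def)
  obtain e :: "'e \<Rightarrow> ('m, 'e) tvec" and b0 where b0: "b0 \<in> Basis" and e: "\<And>b. b \<in> Basis \<Longrightarrow> e b \<in> tangent_space A p"
    and orth: "\<And>b b'. b \<in> Basis \<Longrightarrow> b' \<in> Basis \<Longrightarrow>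
      g p (e b) (e b') = (if b \<noteq> b' then 0 else if b = b0 then -1 else 1)"
    using conjunct2[OF g[unfolded lorentzian_metric_def], THEN spec[of _ p]] by blast
  define s where "s b = (if b = b0 then -1 else (1::real))" for b
  have orth': "g p (e b) (e b') = (if b = b' then s b else 0)" if "b \<in> Basis" "b' \<in> Basis" for b b'
    using orth[OF that] by (simp add: s_def)
  have s: "s b \<noteq> 0" for b by (simp add: s_def)
  obtain y where y: "t = (\<Sum>b\<in>Basis. y b *\<^sub>R e b)"
    by (rule orthogonal_expansion[OF gs e orth' s t(1)])
  obtain z where z: "x = (\<Sum>b\<in>Basis. z b *\<^sub>R e b)"
    by (rule orthogonal_expansion[OF gs e orth' s x(1)])
  let ?B = "Basis - {b0}"
  have form: "g p (\<Sum>b\<in>Basis. f b *\<^sub>R e b) (\<Sum>b\<in>Basis. h b *\<^sub>R e b) =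
      - (f b0 * h b0) + (\<Sum>b\<in>?B. f b * h b)" for f h
  proof -
    let ?h = "\<Sum>b\<in>Basis. h b *\<^sub>R e b"
    have hT: "?h \<in> tangent_space A p"
      using e by (intro subspace_sum[OF subspace_tangent_space] tangent_space_scaleR)
    have "g p (e b) ?h = h b * s b" if b: "b \<in> Basis" for b
    proof -
      have "g p (e b) ?h = (\<Sum>b'\<in>Basis. h b' * g p (e b') (e b))"
        using tensor_sym[OF gs e[OF b] hT] tensor_sum_left[OF gs e e[OF b]] by simp
      also have "\<dots> = (\<Sum>b'\<in>Basis. if b' = b then h b * s b else 0)"
        by (rule sum.cong) (auto simp: orth' b)
      finally show ?thesis using b by simp
    qed
    then have "g p (\<Sum>b\<in>Basis. f b *\<^sub>R e b) ?h = (\<Sum>b\<in>Basis. f b * (h b * s b))"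
      using tensor_sum_left[where I = Basis and e = e, OF gs e hT] by simp
    then show ?thesis
      using b0 by (simp add: sum.remove[of Basis b0] s_def)
  qed
  let ?Y = "\<Sum>b\<in>?B. (y b)\<^sup>2" and ?Z = "\<Sum>b\<in>?B. (z b)\<^sup>2"
  have tt: "?Y = (y b0)\<^sup>2 - 1" using t(2) form[of y y] by (simp flip: y add: power2_eq_square)
  have xx: "g p x x = ?Z - (z b0)\<^sup>2" using form[of z z] by (simp flip: z add: power2_eq_square)
  have "y b0 * z b0 = (\<Sum>b\<in>?B. y b * z b)" using x(2) form[of y z] by (simp flip: y z)
  then have CS: "(y b0)\<^sup>2 * (z b0)\<^sup>2 \<le> ((y b0)\<^sup>2 - 1) * ?Z"
    using Cauchy_Schwarz_ineq_sum[of y z ?B] tt by (simp flip: power_mult_distrib)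
  show ?thesis
  proof (rule ccontr)
    assume "\<not> g p x x > 0"
    then have le: "?Z \<le> (z b0)\<^sup>2" using xx by simp
    have "?Y \<ge> 0" by (simp add: sum_nonneg)
    then have "((y b0)\<^sup>2 - 1) * ?Z \<le> ((y b0)\<^sup>2 - 1) * (z b0)\<^sup>2"
      using le tt by (intro mult_left_mono) auto
    then have "(z b0)\<^sup>2 \<le> 0" using CS unfolding left_diff_distrib by linarith
    then have z0: "z b0 = 0" by simp
    moreover have "?Z \<ge> 0" by (simp add: sum_nonneg)
    ultimately have "?Z = 0" using le by simp
    then have "z b = 0" if "b \<in> Basis" for b
      using that z0 by (cases "b = b0") (simp_all add: sum_nonneg_eq_0_iff)
    then show False using z x(3) by simp
  qed
qed

end


section \<open>The canonical variation along a lightlike hypersurface\<close>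

locale rigged_lightlike_hypersurface = manifold A
  for A :: "('m::{t2_space,second_countable_topology}, 'e::euclidean_space) chart set" +
  fixes gL :: "('m, 'e) tensor2" and nablaL nablaR :: "('m, 'e) connection"
    and H :: "'m set" and E \<xi> :: "'m \<Rightarrow> ('m, 'e) tvec"
  assumes lorentz: "lorentzian_metric A gL"
    and E_field: "vector_field_on A UNIV E"
    and E_unit: "gL q (E q) (E q) = -1"
    and null_hyp: "lightlike_hypersurface A gL H"
    and xi_field: "hyp_vector_field A H \<xi>"
    and xi_null: "q \<in> H \<Longrightarrow> lightlike (gL q) (\<xi> q)"
    and xi_normalized: "q \<in> H \<Longrightarrow> gL q (E q) (\<xi> q) = 1 / sqrt 2"
    and LC_L: "levi_civita A gL nablaL"
    and LC_R: "levi_civita A (canonical_variation gL E) nablaR"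
begin

abbreviation gR :: "('m, 'e) tensor2" where
  "gR \<equiv> canonical_variation gL E"

abbreviation \<omega> :: "'m \<Rightarrow> ('m, 'e) tvec \<Rightarrow> real" where
  "\<omega> q \<equiv> gL q (E q)"

abbreviation N :: "'m \<Rightarrow> ('m, 'e) tvec" where
  "N \<equiv> \<lambda>q. sqrt 2 *\<^sub>R E q + \<xi> q"

abbreviation T :: "'m \<Rightarrow> ('m, 'e) tvec set" where
  "T \<equiv> tangent_space A"

abbreviation TH :: "'m \<Rightarrow> ('m, 'e) tvec set" where
  "TH \<equiv> hyp_tangent_space A H"

lemma hyp: "hypersurface A H"
  using null_hyp by (simp add: lightlike_hypersurface_def)

lemma gL: "smooth_symmetric_tensor A gL"
  using lorentz by (simp add: lorentzian_metric_def)

lemma gR: "smooth_symmetric_tensor A gR"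
  by (rule smooth_symmetric_tensor_canonical_variation[OF gL E_field])

lemma E_in: "E q \<in> T q"
  using vector_field_onD[OF E_field] by simp

lemma hyp_field_in: "hyp_vector_field A H V \<Longrightarrow> q \<in> H \<Longrightarrow> V q \<in> TH q"
  by (simp add: hyp_vector_field_def)

lemma xi_in_TH: "q \<in> H \<Longrightarrow> \<xi> q \<in> TH q"
  by (rule hyp_field_in[OF xi_field])

lemma xi_in: "q \<in> H \<Longrightarrow> \<xi> q \<in> T q"
  by (rule hyp_tangent_space_subset[OF xi_in_TH])

lemma N_in: "q \<in> H \<Longrightarrow> N q \<in> T q"
  by (simp add: tangent_space_add tangent_space_scaleR E_in xi_in)

text \<open>The splitting of a vector into a multiple of \<open>E\<close> and a vector orthogonal to \<open>E\<close>, on which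
  \<open>g\<^sub>L\<close> is positive.\<close>

lemma gL_perp_decomposition:
  assumes u: "u \<in> T q"
  defines "v \<equiv> u + \<omega> q u *\<^sub>R E q"
  shows "v \<in> T q" "gL q u u = gL q v v - (\<omega> q u)\<^sup>2" "gL q v v \<ge> 0" "gL q v v = 0 \<Longrightarrow> v = 0"
proof -
  have rE: "\<omega> q u *\<^sub>R E q \<in> T q" by (rule tangent_space_scaleR[OF E_in])
  show v: "v \<in> T q" unfolding v_def by (rule tangent_space_add[OF u rE])
  have perp: "\<omega> q v = 0"
    unfolding v_def
    by (simp add: tensor_add_right[OF gL E_in u rE] tensor_scaleR_right[OF gL E_in E_in] E_unit)
  have "gL q v v = gL q u v"
    using tensor_add_left[OF gL u rE v] tensor_scaleR_left[OF gL E_in v] perp by (simp add: v_def)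
  also have "\<dots> = gL q u u + (\<omega> q u)\<^sup>2"
    unfolding v_def tensor_add_right[OF gL u u rE] tensor_scaleR_right[OF gL u E_in]
    by (simp add: tensor_sym[OF gL u E_in] power2_eq_square)
  finally show "gL q u u = gL q v v - (\<omega> q u)\<^sup>2" by simp
  have pos: "gL q v v > 0" if "v \<noteq> 0"
    by (rule timelike_perp_positive[OF lorentz E_in E_unit v perp that])
  show "gL q v v \<ge> 0"
    using pos tensor_zero_left[OF gL v] by (cases "v = 0") auto
  show "gL q v v = 0 \<Longrightarrow> v = 0" using pos by force
qed

lemma eq_zeroI:
  assumes "u \<in> T q" "\<omega> q u = 0" "gL q u u \<le> 0"
  shows "u = 0"
  using gL_perp_decomposition[OF assms(1)] assms(2,3) by simp

text \<open>With \<open>u = v - \<omega>(u) E\<close> as above, \<open>g\<^sub>R(u, u) = g\<^sub>L(v, v) + \<omega>(u)\<^sup>2\<close>: the canonical variation is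
  Riemannian.\<close>

lemma gR_definite:
  assumes "u \<in> T q" "gR q u u \<le> 0"
  shows "u = 0"
proof (rule eq_zeroI[OF assms(1)])
  note d = gL_perp_decomposition[OF assms(1)]
  have "gR q u u = gL q u u + 2 * (\<omega> q u)\<^sup>2"
    by (simp add: canonical_variation_eq power2_eq_square)
  then have le: "gL q u u + 2 * (\<omega> q u)\<^sup>2 \<le> 0" using assms(2) by simp
  then have "(\<omega> q u)\<^sup>2 \<le> 0" using d(2,3) by linarith
  then show "\<omega> q u = 0" by simp
  then show "gL q u u \<le> 0" using le by simp
qed

lemma nondegenerate_gR: "nondegenerate gR"
  unfolding nondegenerate_def by (auto intro!: gR_definite)

lemma nondegenerate_gL: "nondegenerate gL"
  unfolding nondegenerate_def
proof (intro allI ballI impI)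
  fix q u assume u: "u \<in> T q" and "\<forall>w\<in>T q. gL q u w = 0"
  then have "gL q u u = 0" "gL q u (E q) = 0" using E_in by auto
  then show "u = 0" using eq_zeroI[OF u] tensor_sym[OF gL u E_in] by simp
qed

text \<open>Two orthogonal null vectors \<open>v\<close> and \<open>\<xi>\<close> are proportional: the combination \<open>\<omega>(\<xi>) v - \<omega>(v) \<xi>\<close> is
  null and orthogonal to \<open>E\<close>. Hence \<open>\<xi>\<close> spans the radical of the degenerate induced metric.\<close>

lemma xi_orthogonal:
  assumes q: "q \<in> H" and w: "w \<in> TH q"
  shows "gL q (\<xi> q) w = 0"
proof -
  obtain v where v: "v \<in> TH q" "v \<noteq> 0" and rad: "\<And>w. w \<in> TH q \<Longrightarrow> gL q v w = 0"
    using null_hyp q by (auto simp: lightlike_hypersurface_def)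
  note vT = hyp_tangent_space_subset[OF v(1)] and wT = hyp_tangent_space_subset[OF w]
  note xT = xi_in[OF q]
  \<comment> \<open>The factor is \<open>\<omega>(v) / \<omega>(\<xi>)\<close>, so \<open>u\<close> is the combination above divided by \<open>\<omega>(\<xi>)\<close>.\<close>
  define r where "r = sqrt 2 * \<omega> q v"
  define u where "u = v - r *\<^sub>R \<xi> q"
  have rx: "r *\<^sub>R \<xi> q \<in> T q" by (rule tangent_space_scaleR[OF xT])
  have uT: "u \<in> T q" unfolding u_def by (rule subspace_diff[OF subspace_tangent_space vT rx])
  have "gL q u z = gL q v z - r * gL q (\<xi> q) z" if "z \<in> T q" for z
    by (simp add: u_def tensor_diff_left[OF gL vT rx that] tensor_scaleR_left[OF gL xT that])
  note u_left = this
  have "gL q (\<xi> q) (\<xi> q) = 0" using xi_null[OF q] by (simp add: lightlike_def)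
  moreover have "gL q (\<xi> q) v = 0" "gL q v v = 0"
    using rad v(1) xi_in_TH[OF q] tensor_sym[OF gL vT xT] by simp_all
  ultimately have "gL q u v = 0" "gL q u (\<xi> q) = 0"
    using u_left[OF vT] u_left[OF xT] tensor_sym[OF gL vT xT] by simp_all
  then have "gL q u u = 0"
    using u_left[OF uT] tensor_sym[OF gL uT vT] tensor_sym[OF gL uT xT] by simp
  moreover have "\<omega> q u = 0"
    using u_left[OF E_in] tensor_sym[OF gL E_in] uT vT xT xi_normalized[OF q]
    by (simp add: r_def)
  ultimately have "u = 0" by (intro eq_zeroI[OF uT]) simp_all
  then have veq: "v = r *\<^sub>R \<xi> q" by (simp add: u_def)
  then have "r \<noteq> 0" using v(2) by auto
  then show ?thesis
    using rad[OF w] tensor_scaleR_left[OF gL xT wT, of r] by (simp add: veq)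
qed

text \<open>The choice of \<open>N\<close>: the part \<open>\<surd>2 \<omega>\<close> of \<open>g\<^sub>L(N, \<cdot>) = \<surd>2 \<omega> + g\<^sub>L(\<xi>, \<cdot>)\<close> is cancelled by
  \<open>2 \<omega>(N) \<omega>\<close>, because \<open>\<omega>(N) = - 1 / \<surd>2\<close>.\<close>

lemma omega_N:
  assumes q: "q \<in> H"
  shows "\<omega> q (N q) = - 1 / sqrt 2"
proof -
  have "\<omega> q (N q) = - sqrt 2 + 1 / sqrt 2"
    using tensor_add_right[OF gL E_in tangent_space_scaleR[OF E_in] xi_in[OF q]]
      tensor_scaleR_right[OF gL E_in E_in] by (simp add: E_unit xi_normalized[OF q])
  also have "\<dots> = - 1 / sqrt 2" by (simp add: field_simps)
  finally show ?thesis .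
qed

lemma gR_N:
  assumes q: "q \<in> H" and w: "w \<in> T q"
  shows "gR q w (N q) = gL q w (\<xi> q)"
proof -
  have "gL q w (N q) = sqrt 2 * \<omega> q w + gL q w (\<xi> q)"
    using tensor_add_right[OF gL w tangent_space_scaleR[OF E_in] xi_in[OF q]]
      tensor_scaleR_right[OF gL w E_in] tensor_sym[OF gL w E_in] by simp
  moreover have "2 * (\<omega> q w * (- 1 / sqrt 2)) = - sqrt 2 * \<omega> q w" by (simp add: field_simps)
  ultimately show ?thesis by (simp only: canonical_variation_eq omega_N[OF q])
qed

lemma gR_N_N:
  assumes q: "q \<in> H"
  shows "gR q (N q) (N q) = 1"
proof -
  have "gL q (N q) (\<xi> q) = sqrt 2 * (1 / sqrt 2) + gL q (\<xi> q) (\<xi> q)"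
    using tensor_add_left[OF gL tangent_space_scaleR[OF E_in] xi_in[OF q] xi_in[OF q]]
      tensor_scaleR_left[OF gL E_in xi_in[OF q]] xi_normalized[OF q] by simp
  then show ?thesis
    using gR_N[OF q N_in[OF q]] xi_null[OF q] by (simp add: lightlike_def)
qed

lemma gR_N_tangent:
  assumes q: "q \<in> H" and w: "w \<in> TH q"
  shows "gR q (N q) w = 0"
proof -
  note wT = hyp_tangent_space_subset[OF w]
  show ?thesis
    using gR_N[OF q wT] tensor_sym[OF gR wT N_in[OF q]] tensor_sym[OF gL wT xi_in[OF q]]
      xi_orthogonal[OF q w] by simp
qed

text \<open>\<open>TH\<close> is a hyperplane that does not contain \<open>N\<close>, so \<open>w = h + t N\<close> with \<open>h\<close> tangent, and
  \<open>t = g\<^sub>R(w, N) = g\<^sub>L(w, \<xi>)\<close>.\<close>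

lemma TH_projection:
  assumes q: "q \<in> H" and w: "w \<in> T q"
  shows "w - gL q w (\<xi> q) *\<^sub>R N q \<in> TH q"
proof -
  have "N q \<notin> TH q" using gR_N_tangent[OF q] gR_N_N[OF q] by force
  then obtain t where t: "w - t *\<^sub>R N q \<in> TH q"
    using hyp_tangent_space_complement[OF hyp q N_in[OF q] _ w] by blast
  note tN = tangent_space_scaleR[OF N_in[OF q]]
  have "gR q (w - t *\<^sub>R N q) (N q) = 0"
    using gR_N_tangent[OF q t] tensor_sym[OF gR hyp_tangent_space_subset[OF t] N_in[OF q]] by simp
  then have "gL q w (\<xi> q) - t = 0"
    using tensor_diff_left[OF gR w tN N_in[OF q]] tensor_scaleR_left[OF gR N_in[OF q] N_in[OF q]]
    by (simp add: gR_N_N[OF q] gR_N[OF q w])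
  then show ?thesis using t by simp
qed

lemma second_fundamental_form_eq:
  assumes q: "q \<in> H" and W: "nabla_along A H nablaR q (U q) V \<in> T q"
  shows "second_fundamental_form A gR nablaR H U V q =
    gL q (nabla_along A H nablaR q (U q) V) (\<xi> q) *\<^sub>R N q"
  unfolding second_fundamental_form_def
proof (rule the_equality)
  let ?W = "nabla_along A H nablaR q (U q) V"
  let ?n = "gL q ?W (\<xi> q) *\<^sub>R N q"
  have n: "?n \<in> T q" by (rule tangent_space_scaleR[OF N_in[OF q]])
  show 1: "?n \<in> T q \<and> (\<forall>w\<in>TH q. gR q ?n w = 0) \<and> ?W - ?n \<in> TH q"
    using n TH_projection[OF q W] gR_N_tangent[OF q]
      tensor_scaleR_left[OF gR N_in[OF q] hyp_tangent_space_subset] by simp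
  fix m assume 2: "m \<in> T q \<and> (\<forall>w\<in>TH q. gR q m w = 0) \<and> ?W - m \<in> TH q"
  have mT: "m \<in> T q" using 2 by simp
  have "(?W - ?n) - (?W - m) \<in> TH q"
    using 1 2 subspace_diff[OF subspace_hyp_tangent_space[OF hyp q]] by blast
  then have d: "m - ?n \<in> TH q" by simp
  then have dT: "m - ?n \<in> T q" by (rule hyp_tangent_space_subset)
  have "gR q (m - ?n) (m - ?n) = 0"
    using tensor_diff_left[OF gR mT n dT] 1 2 d by simp
  then have "m - ?n = 0" by (intro gR_definite[OF dT]) simp
  then show "m = ?n" by simp
qed

text \<open>Both connections are metric, and \<open>g\<^sub>R - g\<^sub>L = 2 \<omega> \<otimes> \<omega>\<close>; the terms without \<open>\<nabla>\<^sup>L E\<close> recombine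
  into \<open>g\<^sub>R\<close>.\<close>

lemma gR_metric:
  assumes U: "open U" "p \<in> U" and X: "vector_field_on A U X" and Y: "vector_field_on A U Y"
    and u: "u \<in> T p"
  shows "gR p (nablaR p u X - nablaL p u X) (Y p) + gR p (X p) (nablaR p u Y - nablaL p u Y) =
    2 * (gL p (nablaL p u E) (X p) * \<omega> p (Y p) + \<omega> p (X p) * gL p (nablaL p u E) (Y p))"
proof -
  have E: "vector_field_on A U E" using vector_field_on_subset[OF E_field] by simp
  note XT = vector_field_onD[OF X U(2)] and YT = vector_field_onD[OF Y U(2)]
  note RX = nabla_in[OF LC_R U X u] and LX = nabla_in[OF LC_L U X u]
  note RY = nabla_in[OF LC_R U Y u] and LY = nabla_in[OF LC_L U Y u]
  note sXY = tensor_smooth[OF gL U(1) X Y]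
    and sX = tensor_smooth[OF gL U(1) E X] and sY = tensor_smooth[OF gL U(1) E Y]
  note sP = smooth_fun_on_mult[OF U(1) sX sY]
  let ?d = "deriv_along A p u"
  have "?d (\<lambda>q. gR q (X q) (Y q)) = ?d (\<lambda>q. gL q (X q) (Y q) + 2 * (\<omega> q (X q) * \<omega> q (Y q)))"
    by (simp add: canonical_variation_eq)
  also have "\<dots> = ?d (\<lambda>q. gL q (X q) (Y q)) +
      2 * (\<omega> p (X p) * ?d (\<lambda>q. \<omega> q (Y q)) + ?d (\<lambda>q. \<omega> q (X q)) * \<omega> p (Y p))"
    using deriv_along_add[OF U sXY smooth_fun_on_mult[OF U(1) smooth_fun_on_const sP] u]
      deriv_along_mult[OF U smooth_fun_on_const sP u, of 2] deriv_along_mult[OF U sX sY u]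
    by (simp add: deriv_along_const)
  finally have
    "gR p (nablaR p u X) (Y p) + gR p (X p) (nablaR p u Y) =
      gL p (nablaL p u X) (Y p) + gL p (X p) (nablaL p u Y) +
      2 * (\<omega> p (X p) * (gL p (nablaL p u E) (Y p) + \<omega> p (nablaL p u Y)) +
        (gL p (nablaL p u E) (X p) + \<omega> p (nablaL p u X)) * \<omega> p (Y p))"
    unfolding nabla_metric[OF LC_R U X Y u] nabla_metric[OF LC_L U X Y u]
      nabla_metric[OF LC_L U E X u] nabla_metric[OF LC_L U E Y u] .
  moreover have "gR p (nablaR p u X - nablaL p u X) (Y p) =
      gR p (nablaR p u X) (Y p) - gR p (nablaL p u X) (Y p)"
    by (rule tensor_diff_left[OF gR RX LX YT])
  moreover have "gR p (X p) (nablaR p u Y - nablaL p u Y) =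
      gR p (X p) (nablaR p u Y) - gR p (X p) (nablaL p u Y)"
    using tensor_diff_left[OF gR RY LY XT] tensor_sym[OF gR XT] RY LY
      subspace_diff[OF subspace_tangent_space RY LY] by simp
  ultimately show ?thesis
    unfolding canonical_variation_eq[of gL E p "nablaL p u X"]
      canonical_variation_eq[of gL E p "X p" "nablaL p u Y"]
    by (simp add: algebra_simps)
qed

text \<open>The difference \<open>D(X, Y) = \<nabla>\<^sup>R\<^sub>X Y - \<nabla>\<^sup>L\<^sub>X Y\<close> is symmetric, both connections being torsion free.
  Adding the preceding identity for \<open>(X; Y, Z)\<close> and \<open>(Y; X, Z)\<close> and subtracting the one for
  \<open>(Z; X, Y)\<close> isolates \<open>2 g\<^sub>R(D(X, Y), Z)\<close>, as in the Koszul formula.\<close>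

lemma difference_of_connections:
  assumes U: "open U" "p \<in> U" and X: "vector_field_on A U X" and Y: "vector_field_on A U Y"
    and Z: "vector_field_on A U Z"
  defines "a \<equiv> \<lambda>u v. gL p (nablaL p u E) v"
  shows "gR p (nablaR p (X p) Y - nablaL p (X p) Y) (Z p) =
    \<omega> p (Z p) * (a (X p) (Y p) + a (Y p) (X p)) + \<omega> p (Y p) * (a (X p) (Z p) - a (Z p) (X p)) +
    \<omega> p (X p) * (a (Y p) (Z p) - a (Z p) (Y p))"
proof -
  define D where "D V W = nablaR p (V p) W - nablaL p (V p) W" for V W
  have T: "V p \<in> T p" if "vector_field_on A U V" for V
    by (rule vector_field_onD[OF that U(2)])
  have DT: "D V W \<in> T p" if "vector_field_on A U V" "vector_field_on A U W" for V W
    unfolding D_def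
    by (rule subspace_diff[OF subspace_tangent_space nabla_in[OF LC_R U that(2) T[OF that(1)]]
          nabla_in[OF LC_L U that(2) T[OF that(1)]]])
  have sym: "D V W = D W V" if "vector_field_on A U V" "vector_field_on A U W" for V W
  proof -
    have "nablaR p (V p) W - nablaR p (W p) V = nablaL p (V p) W - nablaL p (W p) V"
      using nabla_torsion_free[OF LC_R U that] nabla_torsion_free[OF LC_L U that] by simp
    then show ?thesis by (simp add: D_def algebra_simps)
  qed
  note gRs = tensor_sym[OF gR]
  have "gR p (D X Y) (Z p) + gR p (Y p) (D X Z) =
      2 * (a (X p) (Y p) * \<omega> p (Z p) + \<omega> p (Y p) * a (X p) (Z p))"
    unfolding D_def a_def by (rule gR_metric[OF U Y Z T[OF X]])
  moreover have "gR p (D X Y) (Z p) + gR p (X p) (D Y Z) =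
      2 * (a (Y p) (X p) * \<omega> p (Z p) + \<omega> p (X p) * a (Y p) (Z p))"
    unfolding sym[OF X Y] unfolding D_def a_def by (rule gR_metric[OF U X Z T[OF Y]])
  moreover have "gR p (Y p) (D X Z) + gR p (X p) (D Y Z) =
      2 * (a (Z p) (X p) * \<omega> p (Y p) + \<omega> p (X p) * a (Z p) (Y p))"
    unfolding sym[OF X Z] sym[OF Y Z] gRs[OF T[OF Y] DT[OF Z X]]
    unfolding D_def a_def by (rule gR_metric[OF U X Y T[OF Z]])
  ultimately show ?thesis by (simp add: D_def algebra_simps)
qed


section \<open>The second fundamental form\<close>

lemma common_extension:
  assumes p: "p \<in> H" and V: "hyp_vector_field A H V" and W: "hyp_vector_field A H W"
  shows "\<exists>U V' W' \<xi>'. open U \<and> p \<in> U \<and>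
    vector_field_on A U V' \<and> (\<forall>q\<in>U \<inter> H. V' q = V q) \<and>
    vector_field_on A U W' \<and> (\<forall>q\<in>U \<inter> H. W' q = W q) \<and>
    vector_field_on A U \<xi>' \<and> (\<forall>q\<in>U \<inter> H. \<xi>' q = \<xi> q)"
proof -
  obtain U1 V' where 1: "open U1" "p \<in> U1" "vector_field_on A U1 V'" "\<forall>q\<in>U1 \<inter> H. V' q = V q"
    using ex_extension[OF hyp p V] by blast
  obtain U2 W' where 2: "open U2" "p \<in> U2" "vector_field_on A U2 W'" "\<forall>q\<in>U2 \<inter> H. W' q = W q"
    using ex_extension[OF hyp p W] by blast
  obtain U3 \<xi>' where 3: "open U3" "p \<in> U3" "vector_field_on A U3 \<xi>'" "\<forall>q\<in>U3 \<inter> H. \<xi>' q = \<xi> q"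
    using ex_extension[OF hyp p xi_field] by blast
  show ?thesis
  proof (intro exI conjI)
    show "vector_field_on A (U1 \<inter> U2 \<inter> U3) V'" by (rule vector_field_on_subset[OF 1(3)]) blast
    show "vector_field_on A (U1 \<inter> U2 \<inter> U3) W'" by (rule vector_field_on_subset[OF 2(3)]) blast
    show "vector_field_on A (U1 \<inter> U2 \<inter> U3) \<xi>'" by (rule vector_field_on_subset[OF 3(3)]) blast
  qed (use 1 2 3 in auto)
qed

text \<open>The relations \<open>g\<^sub>L(\<xi>, V) = 0\<close> and \<open>\<omega>(\<xi>) = 1 / \<surd>2\<close> hold only on \<open>H\<close>; they may still be
  differentiated in tangent directions.\<close>

lemma gL_nabla_const_on_H:
  assumes p: "p \<in> H" and u: "u \<in> TH p" and U: "open U" "p \<in> U"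
    and V: "vector_field_on A U V" and W: "vector_field_on A U W"
    and const: "\<And>q. q \<in> U \<Longrightarrow> q \<in> H \<Longrightarrow> gL q (V q) (W q) = r"
  shows "gL p (nablaL p u V) (W p) = - gL p (V p) (nablaL p u W)"
  using deriv_along_const_on_hypersurface[OF U tensor_smooth[OF gL U(1) V W] p u const]
    nabla_metric[OF LC_L U V W hyp_tangent_space_subset[OF u]] by simp

lemmas nabla_along_L = nabla_along_eq[OF gL nondegenerate_gL LC_L]
  and nabla_along_R = nabla_along_eq[OF gR nondegenerate_gR LC_R]

lemma nabla_along_in:
  assumes p: "p \<in> H" and u: "u \<in> TH p" and V: "hyp_vector_field A H V"
  shows "nabla_along A H nablaL p u V \<in> T p" "nabla_along A H nablaR p u V \<in> T p"
proof -
  obtain U V' where U: "open U" "p \<in> U" "vector_field_on A U V'" "\<And>q. q \<in> U \<inter> H \<Longrightarrow> V' q = V q"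
    using ex_extension[OF hyp p V] by blast
  note uT = hyp_tangent_space_subset[OF u]
  show "nabla_along A H nablaL p u V \<in> T p" "nabla_along A H nablaR p u V \<in> T p"
    using nabla_in[OF LC_L U(1-3) uT] nabla_in[OF LC_R U(1-3) uT]
      nabla_along_L[OF p u U] nabla_along_R[OF p u U] by simp_all
qed

lemma nabla_along_xi:
  assumes p: "p \<in> H" and u: "u \<in> TH p" and V: "hyp_vector_field A H V"
  shows "gL p (nabla_along A H nablaL p u V) (\<xi> p) = - gL p (nabla_along A H nablaL p u \<xi>) (V p)"
proof -
  obtain U V' W' \<xi>' where U: "open U" "p \<in> U"
    and V': "vector_field_on A U V'" "\<And>q. q \<in> U \<inter> H \<Longrightarrow> V' q = V q"
    and xi': "vector_field_on A U \<xi>'" "\<And>q. q \<in> U \<inter> H \<Longrightarrow> \<xi>' q = \<xi> q"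
    using common_extension[OF p V V] by blast
  have "gL q (V' q) (\<xi>' q) = 0" if "q \<in> U" "q \<in> H" for q
    using that V'(2) xi'(2) xi_orthogonal[OF that(2) hyp_field_in[OF V that(2)]]
      tensor_sym[OF gL xi_in[OF that(2)] hyp_tangent_space_subset[OF hyp_field_in[OF V that(2)]]]
    by simp
  from gL_nabla_const_on_H[OF p u U V'(1) xi'(1) this]
  have "gL p (nablaL p u V') (\<xi>' p) = - gL p (V' p) (nablaL p u \<xi>')" .
  moreover have "gL p (V' p) (nablaL p u \<xi>') = gL p (nablaL p u \<xi>') (V' p)"
    using tensor_sym[OF gL] vector_field_onD[OF V'(1) U(2)]
      nabla_in[OF LC_L U xi'(1) hyp_tangent_space_subset[OF u]] by blast
  ultimately show ?thesis
    using p U(2) V'(2) xi'(2) nabla_along_L[OF p u U V'] nabla_along_L[OF p u U xi'] by simp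
qed

lemma xi_nabla_along_xi:
  assumes p: "p \<in> H" and u: "u \<in> TH p"
  shows "gL p (nabla_along A H nablaL p u \<xi>) (\<xi> p) = 0"
  using nabla_along_xi[OF p u xi_field] by simp

lemma omega_nabla_along_xi:
  assumes p: "p \<in> H" and u: "u \<in> TH p"
  shows "\<omega> p (nabla_along A H nablaL p u \<xi>) = - gL p (nablaL p u E) (\<xi> p)"
proof -
  obtain U \<xi>' where U: "open U" "p \<in> U"
    and xi': "vector_field_on A U \<xi>'" "\<And>q. q \<in> U \<inter> H \<Longrightarrow> \<xi>' q = \<xi> q"
    using ex_extension[OF hyp p xi_field] by blast
  have E: "vector_field_on A U E" using vector_field_on_subset[OF E_field] by simp
  have "gL q (E q) (\<xi>' q) = 1 / sqrt 2" if "q \<in> U" "q \<in> H" for q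
    using that xi'(2) xi_normalized by simp
  from gL_nabla_const_on_H[OF p u U E xi'(1) this] show ?thesis
    using p U(2) xi'(2) nabla_along_L[OF p u U xi'] by simp
qed

lemma nabla_E_perp:
  assumes u: "u \<in> T p"
  shows "gL p (nablaL p u E) (E p) = 0"
proof -
  have "deriv_along A p u (\<lambda>q. gL q (E q) (E q)) = 0"
    by (simp add: E_unit deriv_along_const)
  then show ?thesis
    using nabla_metric[OF LC_L open_UNIV UNIV_I E_field E_field u]
      tensor_sym[OF gL E_in nabla_in[OF LC_L open_UNIV UNIV_I E_field u]] by simp
qed

text \<open>The coefficient is \<open>g\<^sub>L(\<nabla>\<^sup>R\<^sub>V W, \<xi>) = g\<^sub>L(\<nabla>\<^sup>L\<^sub>V W, \<xi>) + g\<^sub>R(D(V, W), N)\<close>, where \<open>D\<close> is the difference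
  of the connections. The factors \<open>\<omega>\<close> vanish on the screen and equal \<open>1 / \<surd>2\<close> on \<open>\<xi>\<close>, which yields
  the three cases of the theorem.\<close>

lemma second_fundamental_form_gR:
  assumes p: "p \<in> H" and V: "hyp_vector_field A H V" and W: "hyp_vector_field A H W"
  defines "a \<equiv> \<lambda>u v. gL p (nablaL p u E) v"
  shows "second_fundamental_form A gR nablaR H V W p =
    (gL p (nabla_along A H nablaL p (V p) W) (\<xi> p)
      - 1 / sqrt 2 * (a (V p) (W p) + a (W p) (V p))
      + \<omega> p (W p) * (a (V p) (\<xi> p) - sqrt 2 * a (E p) (V p) - a (\<xi> p) (V p))
      + \<omega> p (V p) * (a (W p) (\<xi> p) - sqrt 2 * a (E p) (W p) - a (\<xi> p) (W p))) *\<^sub>R N p"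
proof -
  obtain U V' W' \<xi>' where U: "open U" "p \<in> U"
    and V': "vector_field_on A U V'" "\<And>q. q \<in> U \<inter> H \<Longrightarrow> V' q = V q"
    and W': "vector_field_on A U W'" "\<And>q. q \<in> U \<inter> H \<Longrightarrow> W' q = W q"
    and xi': "vector_field_on A U \<xi>'" "\<And>q. q \<in> U \<inter> H \<Longrightarrow> \<xi>' q = \<xi> q"
    using common_extension[OF p V W] by blast
  have at_p: "V' p = V p" "W' p = W p" "\<xi>' p = \<xi> p" using p U V' W' xi' by simp_all
  have E: "vector_field_on A U E" using vector_field_on_subset[OF E_field] by simp
  let ?N = "\<lambda>q. sqrt 2 *\<^sub>R E q + \<xi>' q"
  have N': "vector_field_on A U ?N"
    by (rule vector_field_on_add[OF U(1) vector_field_on_scaleR[OF U(1) E] xi'(1)])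
  note VH = hyp_field_in[OF V p]
  note VT = hyp_tangent_space_subset[OF VH] and WT = hyp_tangent_space_subset[OF hyp_field_in[OF W p]]
  note xiT = xi_in[OF p]
  note rE = tangent_space_scaleR[OF E_in, of "sqrt 2" p]
  note nE = nabla_in[OF LC_L U E]
  have a_left: "a (N p) v = sqrt 2 * a (E p) v + a (\<xi> p) v" if v: "v \<in> T p" for v
    using nabla_add[OF LC_L U E rE xiT] nabla_scaleR[OF LC_L U E E_in, of "sqrt 2"]
      tensor_add_left[OF gL tangent_space_scaleR[OF nE[OF E_in]] nE[OF xiT] v]
      tensor_scaleR_left[OF gL nE[OF E_in] v] by (simp add: a_def)
  have a_right: "a v (N p) = a v (\<xi> p)" if v: "v \<in> T p" for v
    using tensor_add_right[OF gL nE[OF v] rE xiT] tensor_scaleR_right[OF gL nE[OF v] E_in]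
      nabla_E_perp[OF v] by (simp add: a_def)
  note L = nabla_along_in(1)[OF p VH W] and R = nabla_along_in(2)[OF p VH W]
  let ?L = "nabla_along A H nablaL p (V p) W" and ?R = "nabla_along A H nablaR p (V p) W"
  have "gL p ?R (\<xi> p) - gL p ?L (\<xi> p) = gR p (?R - ?L) (N p)"
    using gR_N[OF p subspace_diff[OF subspace_tangent_space R L]] tensor_diff_left[OF gL R L xiT]
    by simp
  also have "\<dots> = \<omega> p (N p) * (a (V p) (W p) + a (W p) (V p))
      + \<omega> p (W p) * (a (V p) (N p) - a (N p) (V p))
      + \<omega> p (V p) * (a (W p) (N p) - a (N p) (W p))"
    using difference_of_connections[OF U V'(1) W'(1) N']
    by (simp only: a_def at_p nabla_along_L[of p H _ _ W' W, OF p VH U W']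
        nabla_along_R[of p H _ _ W' W, OF p VH U W'])
  finally have "gL p ?R (\<xi> p) = gL p ?L (\<xi> p)
      - 1 / sqrt 2 * (a (V p) (W p) + a (W p) (V p))
      + \<omega> p (W p) * (a (V p) (\<xi> p) - sqrt 2 * a (E p) (V p) - a (\<xi> p) (V p))
      + \<omega> p (V p) * (a (W p) (\<xi> p) - sqrt 2 * a (E p) (W p) - a (\<xi> p) (W p))"
    unfolding omega_N[OF p] a_left[OF VT] a_left[OF WT] a_right[OF VT] a_right[OF WT] by (simp add: diff_diff_eq)
  then show ?thesis using second_fundamental_form_eq[of p V W, OF p R] by simp
qed

text \<open>\<open>\<nabla>\<^sup>L\<^sub>u \<xi>\<close> is orthogonal to \<open>\<xi>\<close>, hence tangent to \<open>H\<close>. Since \<open>\<omega>\<close> vanishes on the screen,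
  applying it to \<open>\<nabla>\<^sup>L\<^sub>u \<xi> = - t \<xi> - a\<close> yields \<open>t = - \<surd>2 \<omega>(\<nabla>\<^sup>L\<^sub>u \<xi>)\<close>, and
  \<open>\<omega>(\<nabla>\<^sup>L\<^sub>u \<xi>) = - g\<^sub>L(\<nabla>\<^sup>L\<^sub>u E, \<xi>)\<close> because \<open>\<omega>(\<xi>)\<close> is constant on \<open>H\<close>.\<close>

lemma rotation_form_eq:
  assumes p: "p \<in> H" and u: "u \<in> TH p"
  shows "rotation_form A gL nablaL H E \<xi> p u = sqrt 2 * gL p (nablaL p u E) (\<xi> p)"
  unfolding rotation_form_def
proof (rule the_equality)
  let ?w = "nabla_along A H nablaL p u \<xi>"
  let ?t = "sqrt 2 * gL p (nablaL p u E) (\<xi> p)"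
  note w = nabla_along_in(1)[OF p u xi_field] and sub = subspace_hyp_tangent_space[OF hyp p]
  have wH: "?w \<in> TH p"
    using TH_projection[OF p w] xi_nabla_along_xi[OF p u] by simp
  have omega: "\<omega> p (- (t *\<^sub>R \<xi> p) - a) = - t / sqrt 2 - \<omega> p a" if a: "a \<in> T p" for t a
    using tensor_add_right[OF gL E_in tangent_space_scaleR[OF xi_in[OF p], of "- t"]
          tangent_space_scaleR[OF a, of "-1"]]
      tensor_scaleR_right[OF gL E_in xi_in[OF p], of "- t"]
      tensor_scaleR_right[OF gL E_in a, of "-1"] xi_normalized[OF p] by simp
  let ?a = "- (?t *\<^sub>R \<xi> p) - ?w"
  have "?a \<in> TH p"
    using subspace_diff[OF sub subspace_neg[OF sub subspace_scale[OF sub xi_in_TH[OF p]]] wH] .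
  moreover have "\<omega> p ?a = 0"
    using omega[OF w, of ?t] omega_nabla_along_xi[OF p u] by simp
  ultimately have "?a \<in> screen A gL H E p" by (simp add: screen_def)
  moreover have "?w = - (?t *\<^sub>R \<xi> p) - ?a" by simp
  ultimately show "\<exists>a\<in>screen A gL H E p. ?w = - (?t *\<^sub>R \<xi> p) - a" by blast
  fix t assume "\<exists>a\<in>screen A gL H E p. ?w = - (t *\<^sub>R \<xi> p) - a"
  then obtain a where a: "a \<in> TH p" "\<omega> p a = 0" "?w = - (t *\<^sub>R \<xi> p) - a"
    by (auto simp: screen_def)
  have "- gL p (nablaL p u E) (\<xi> p) = - t / sqrt 2"
    using omega[OF hyp_tangent_space_subset[OF a(1)], of t] a(2) omega_nabla_along_xi[OF p u]
    unfolding a(3) by simp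
  then show "t = ?t" by (simp add: field_simps)
qed

end

theorem proposition6p1:
  fixes A :: "('m::{t2_space,second_countable_topology}, 'e::euclidean_space) chart set"
    and gL gR :: "('m, 'e) tensor2"
    and nablaL nablaR :: "('m, 'e) connection"
    and H :: "'m set"
    and E \<xi> N X Y :: "'m \<Rightarrow> ('m, 'e) tvec"
    and p :: 'm
  assumes manifold: "smooth_structure A"
    and lorentz: "lorentzian_metric A gL"
    and E_field: "vector_field_on A UNIV E"
    and E_unit: "\<And>q. gL q (E q) (E q) = -1"
    and null_hyp: "lightlike_hypersurface A gL H"
    and xi_field: "hyp_vector_field A H \<xi>"
    and xi_null: "\<And>q. q \<in> H \<Longrightarrow> lightlike (gL q) (\<xi> q)"
    and xi_normalized: "\<And>q. q \<in> H \<Longrightarrow> gL q (E q) (\<xi> q) = 1 / sqrt 2"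
    and N_eq: "N = (\<lambda>q. sqrt 2 *\<^sub>R E q + \<xi> q)"
    and gR_eq: "gR = canonical_variation gL E"
    and LC_L: "levi_civita A gL nablaL"
    and LC_R: "levi_civita A gR nablaR"
    and X_screen: "screen_field A gL H E X"
    and Y_screen: "screen_field A gL H E Y"
    and p_in: "p \<in> H"
  shows "second_fundamental_form A gR nablaR H X Y p =
           (null_second_fundamental_form A gL nablaL H \<xi> X Y p
            - 1 / sqrt 2 * lie_derivative A E gL p (X p) (Y p)) *\<^sub>R N p
       \<and> second_fundamental_form A gR nablaR H X \<xi> p =
           (- gL p (nablaL p (E p + sqrt 2 *\<^sub>R \<xi> p) E) (X p)) *\<^sub>R N p
       \<and> second_fundamental_form A gR nablaR H \<xi> \<xi> p =
           (- (2 * gL p (\<xi> p) (nablaL p (E p) E)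
               + rotation_form A gL nablaL H E \<xi> p (\<xi> p))) *\<^sub>R N p"
proof -
  interpret rigged_lightlike_hypersurface A gL nablaL nablaR H E \<xi>
    using assms unfolding gR_eq
    by (auto intro!: rigged_lightlike_hypersurface.intro manifold.intro
        rigged_lightlike_hypersurface_axioms.intro)
  note p = p_in
  have X: "hyp_vector_field A H X" "gL p (E p) (X p) = 0"
    and Y: "hyp_vector_field A H Y" "gL p (E p) (Y p) = 0"
    using X_screen Y_screen p by (simp_all add: screen_field_def screen_def)
  note XH = hyp_field_in[OF X(1) p] and xiH = xi_in_TH[OF p] and xiT = xi_in[OF p]
  note XT = hyp_tangent_space_subset[OF XH]
    and YT = hyp_tangent_space_subset[OF hyp_field_in[OF Y(1) p]]
  note nE = nabla_in[OF LC_L open_UNIV UNIV_I E_field]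
  let ?a = "\<lambda>u v. gL p (nablaL p u E) v"

  have "second_fundamental_form A gR nablaR H X Y p =
      (null_second_fundamental_form A gL nablaL H \<xi> X Y p
        - 1 / sqrt 2 * lie_derivative A E gL p (X p) (Y p)) *\<^sub>R N p"
    using second_fundamental_form_gR[OF p X(1) Y(1)] nabla_along_xi[OF p XH Y(1)] X(2) Y(2)
      lie_derivative_eq[OF gL LC_L E_field XT YT]
    by (simp add: gR_eq N_eq null_second_fundamental_form_def)

  moreover have "second_fundamental_form A gR nablaR H X \<xi> p =
      (- gL p (nablaL p (E p + sqrt 2 *\<^sub>R \<xi> p) E) (X p)) *\<^sub>R N p"
  proof -
    have "?a (E p + sqrt 2 *\<^sub>R \<xi> p) (X p) = ?a (E p) (X p) + sqrt 2 * ?a (\<xi> p) (X p)"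
      using nabla_add[OF LC_L open_UNIV UNIV_I E_field E_in tangent_space_scaleR[OF xiT]]
        nabla_scaleR[OF LC_L open_UNIV UNIV_I E_field xiT]
        tensor_add_left[OF gL nE[OF E_in] tangent_space_scaleR[OF nE[OF xiT]] XT]
        tensor_scaleR_left[OF gL nE[OF xiT] XT] by simp
    moreover have "- (1 / sqrt 2 * (x + z)) + 1 / sqrt 2 * (x - sqrt 2 * y - z) = - (y + sqrt 2 * z)"
      for x y z :: real
      by (simp add: field_simps)
    ultimately show ?thesis
      using second_fundamental_form_gR[OF p X(1) xi_field] xi_nabla_along_xi[OF p XH] X(2)
        xi_normalized[OF p]
      by (simp add: gR_eq N_eq)
  qed

  moreover have "second_fundamental_form A gR nablaR H \<xi> \<xi> p =
      (- (2 * gL p (\<xi> p) (nablaL p (E p) E) + rotation_form A gL nablaL H E \<xi> p (\<xi> p))) *\<^sub>R N p"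
  proof -
    have "- (1 / sqrt 2 * (z + z)) + 1 / sqrt 2 * (z - sqrt 2 * y - z) + 1 / sqrt 2 * (z - sqrt 2 * y - z)
        = - (2 * y + sqrt 2 * z)" for y z :: real
      by (simp add: field_simps)
    then show ?thesis
      using second_fundamental_form_gR[OF p xi_field xi_field] xi_nabla_along_xi[OF p xiH]
        xi_normalized[OF p] rotation_form_eq[OF p xiH] tensor_sym[OF gL xiT nE[OF E_in]]
      by (simp add: gR_eq N_eq)
  qed

  ultimately show ?thesis by blast
qed

end
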